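(* Every (finite) letter-affine automatic algebra is dualizable.
   Context: **Automatic algebras.** An automatic algebra is an algebra with a single binary operation $\mathbf M = \langle Q \cup \Sigma \cup \{0\}; \cdot\rangle$, where $Q$ (states) and $\Sigma$ (letters) are disjoint sets and $0 \notin Q\cup\Sigma$, that encodes a partial (deterministic) automaton: each letter $a \in \Sigma$ acts as a partial map $Q \to Q$; for $q,r\in Q$ and $a \in \Sigma$ we have $q\cdot a = r$ iff $a$ sends $q$ to $r$; all other products are $0$. A component of $\mathbf M$ is a connected component $C\subseteq Q$ of the graph on $Q$ in which $q\sim r$ iff $qa=r$ or $ra=q$ for some $a\in\Sigma$; the corresponding component subalgebra is the subalgebra of $\mathbf M$ with universe $C\cup\Sigma\cup\{0\}$. $\mathbf M$ is connected if it has only one component. **Letter-affine.** A finite connected automatic algebra $\mathbf M = \langle Q \cup \Sigma \cup \{0\}; \cdot\rangle$ is letter-affine if (1) each $a \in \Sigma$ acts as a permutation $\rho_a$ of $Q$; (2) the permutations in $\{\rho_a \mid a \in \Sigma\}$ commute; and (3) for all $a,b,c \in \Sigma$ there exists $d \in \Sigma$ such that $\rho_a \circ \rho_b^{-1} \circ \rho_c = \rho_d$. A finite automatic algebra is letter-affine if each of its component subalgebras is letter-affine. **Dualizability.** Let $\mathbf M$ be a finite algebra with universe $M$. A $k$-ary relation on $M$ ($k\ge 1$) is compatible with $\mathbf M$ if it is a subuniverse of $\mathbf M^k$. For $\mathbf A \in \mathbb{ISP}(\mathbf M)$ (isomorphic copies of subalgebras of powers of $\mathbf M$), view $\hom(\mathbf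 A,\mathbf M)\subseteq M^A$ with the subspace topology of the product topology ($M$ discrete), and with relations on $M$ interpreted pointwise. A map $f\colon \hom(\mathbf A,\mathbf M)\to M$ is an evaluation if there is $a\in A$ with $f(x)=x(a)$ for all $x$. The algebra $\mathbf M$ is dualizable if, for every $\mathbf A\in\mathbb{ISP}(\mathbf M)$, every continuous map $f\colon\hom(\mathbf A,\mathbf M)\to M$ that preserves all finitary compatible relations on $\mathbf M$ is an evaluation. *)

theory Defs
  imports "HOL-Analysis.Function_Topology" "HOL-Combinatorics.Permutations"
begin

section \<open>Algebras with a single binary operation\<close>

text \<open>Only the values of the operation on the universe are meaningful.\<close>

record 'a magma =
  univ :: "'a set"
  opn :: "'a \<Rightarrow> 'a \<Rightarrow> 'a"

text \<open>There are no nullary operations, so the empty set is a subuniverse.\<close>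

definition subuniverse :: "'a set \<Rightarrow> ('a, 'r) magma_scheme \<Rightarrow> bool" where
  "subuniverse B A \<longleftrightarrow> B \<subseteq> univ A \<and> (\<forall>x\<in>B. \<forall>y\<in>B. opn A x y \<in> B)"

definition is_magma :: "('a, 'r) magma_scheme \<Rightarrow> bool" where
  "is_magma A \<longleftrightarrow> subuniverse (univ A) A"

definition power_magma :: "('a, 'r) magma_scheme \<Rightarrow> 'i set \<Rightarrow> ('i \<Rightarrow> 'a) magma" where
  "power_magma A I =
     \<lparr>univ = I \<rightarrow>\<^sub>E univ A, opn = (\<lambda>x y. \<lambda>i\<in>I. opn A (x i) (y i))\<rparr>"

text \<open>Homomorphisms are extensional outside the universe of the domain, so that
  \<^term>\<open>homs A B\<close> is a subset of the topological space
  \<^term>\<open>product_topology (\<lambda>_. discrete_topology (univ B)) (univ A)\<close>.\<close>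

definition homs :: "('a, 'r) magma_scheme \<Rightarrow> ('b, 's) magma_scheme \<Rightarrow> ('a \<Rightarrow> 'b) set" where
  "homs A B = {h \<in> univ A \<rightarrow>\<^sub>E univ B.
     \<forall>x\<in>univ A. \<forall>y\<in>univ A. h (opn A x y) = opn B (h x) (h y)}"

definition isomorphic :: "('a, 'r) magma_scheme \<Rightarrow> ('b, 's) magma_scheme \<Rightarrow> bool" where
  "isomorphic A B \<longleftrightarrow> (\<exists>h\<in>homs A B. bij_betw h (univ A) (univ B))"

text \<open>The exponents range over the subsets of the type given by the first argument.\<close>

definition in_ISP :: "'i itself \<Rightarrow> ('b, 's) magma_scheme \<Rightarrow> ('a, 'r) magma_scheme \<Rightarrow> bool" where
  "in_ISP _ A M \<longleftrightarrow> is_magma A \<and>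
     (\<exists>(I :: 'i set) B. subuniverse B (power_magma M I) \<and>
        isomorphic A (power_magma M I \<lparr>univ := B\<rparr>))"

section \<open>Dualizability\<close>

definition compatible_relation ::
    "('a, 'r) magma_scheme \<Rightarrow> nat \<Rightarrow> (nat \<Rightarrow> 'a) set \<Rightarrow> bool" where
  "compatible_relation M k R \<longleftrightarrow> k \<ge> 1 \<and> subuniverse R (power_magma M {..<k})"

definition hom_topology ::
    "('b, 's) magma_scheme \<Rightarrow> ('a, 'r) magma_scheme \<Rightarrow> ('b \<Rightarrow> 'a) topology" where
  "hom_topology A M =
     subtopology (product_topology (\<lambda>_. discrete_topology (univ M)) (univ A)) (homs A M)"

definition preserves_relation ::
    "('b, 's) magma_scheme \<Rightarrow> ('a, 'r) magma_scheme \<Rightarrow> (('b \<Rightarrow> 'a) \<Rightarrow> 'a) \<Rightarrow>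
      nat \<Rightarrow> (nat \<Rightarrow> 'a) set \<Rightarrow> bool" where
  "preserves_relation A M f k R \<longleftrightarrow>
     (\<forall>x \<in> {..<k} \<rightarrow> homs A M.
        (\<forall>a\<in>univ A. (\<lambda>i\<in>{..<k}. x i a) \<in> R) \<longrightarrow> (\<lambda>i\<in>{..<k}. f (x i)) \<in> R)"

definition evaluation ::
    "('b, 's) magma_scheme \<Rightarrow> ('a, 'r) magma_scheme \<Rightarrow> (('b \<Rightarrow> 'a) \<Rightarrow> 'a) \<Rightarrow> bool" where
  "evaluation A M f \<longleftrightarrow> (\<exists>a\<in>univ A. \<forall>x\<in>homs A M. f x = x a)"

text \<open>HOL cannot quantify over types inside a formula: the types of the elements of the
  algebras \<open>A\<close> and of the exponents of the powers of \<open>M\<close> are parameters. Dualizability is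
  the statement for all instances of \<open>'b\<close> and \<open>'i\<close>.\<close>

definition dualizable :: "'b itself \<Rightarrow> 'i itself \<Rightarrow> ('a, 'r) magma_scheme \<Rightarrow> bool" where
  "dualizable _ _ M \<longleftrightarrow>
     (\<forall>A :: 'b magma. in_ISP TYPE('i) A M \<longrightarrow>
        (\<forall>f. continuous_map (hom_topology A M) (discrete_topology (univ M)) f \<and>
             (\<forall>k R. compatible_relation M k R \<longrightarrow> preserves_relation A M f k R)
          \<longrightarrow> evaluation A M f))"

section \<open>Automatic algebras\<close>

record 'a automatic = "'a magma" +
  states :: "'a set"
  letters :: "'a set"
  zero :: 'a

text \<open>The letter \<open>a\<close> acts as the partial map that sends \<open>q\<close> to \<open>opn M q a\<close> if this is a
  state and is undefined at \<open>q\<close> if this is \<open>zero M\<close>.\<close>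

definition automatic_algebra :: "'a automatic \<Rightarrow> bool" where
  "automatic_algebra M \<longleftrightarrow>
     univ M = states M \<union> letters M \<union> {zero M} \<and>
     states M \<inter> letters M = {} \<and>
     zero M \<notin> states M \<union> letters M \<and>
     (\<forall>q\<in>states M. \<forall>a\<in>letters M. opn M q a \<in> states M \<union> {zero M}) \<and>
     (\<forall>x\<in>univ M. \<forall>y\<in>univ M. \<not> (x \<in> states M \<and> y \<in> letters M) \<longrightarrow> opn M x y = zero M)"

definition state_graph :: "'a automatic \<Rightarrow> ('a \<times> 'a) set" where
  "state_graph M = {(q, r). q \<in> states M \<and> r \<in> states M \<and>
     (\<exists>a\<in>letters M. opn M q a = r \<or> opn M r a = q)}"

definition components :: "'a automatic \<Rightarrow> 'a set set" where
  "components M = states M // {(q, r) \<in> states M \<times> states M. (q, r) \<in> (state_graph M)\<^sup>*}"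

definition component_subalgebra :: "'a automatic \<Rightarrow> 'a set \<Rightarrow> 'a automatic" where
  "component_subalgebra M C = M\<lparr>univ := C \<union> letters M \<union> {zero M}, states := C\<rparr>"

text \<open>The action of a letter that is defined on all states, extended by the identity outside
  the set of states, as \<^const>\<open>permutes\<close> requires.\<close>

definition letter_action :: "'a automatic \<Rightarrow> 'a \<Rightarrow> 'a \<Rightarrow> 'a" where
  "letter_action M a = (\<lambda>q. if q \<in> states M then opn M q a else q)"

definition letter_affine_connected :: "'a automatic \<Rightarrow> bool" where
  "letter_affine_connected M \<longleftrightarrow>
     (\<exists>C. components M = {C}) \<and>
     (\<forall>a\<in>letters M. letter_action M a permutes states M) \<and>
     (\<forall>a\<in>letters M. \<forall>b\<in>letters M.
        letter_action M a \<circ> letter_action M b = letter_action M b \<circ> letter_action M a) \<and>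
     (\<forall>a\<in>letters M. \<forall>b\<in>letters M. \<forall>c\<in>letters M. \<exists>d\<in>letters M.
        letter_action M a \<circ> inv (letter_action M b) \<circ> letter_action M c = letter_action M d)"

text \<open>The component subalgebras of an automatic algebra are connected automatic algebras.\<close>

definition letter_affine :: "'a automatic \<Rightarrow> bool" where
  "letter_affine M \<longleftrightarrow>
     (\<forall>C\<in>components M. letter_affine_connected (component_subalgebra M C))"

end

theory Submission
  imports Defs "HOL-Number_Theory.Cong" "HOL-Library.Multiset" "HOL-Combinatorics.Cycles"
begin

text \<open>
  Let \<open>f\<close> be a continuous map on \<open>homs A M\<close> that preserves all finitary compatible relations.
  Two facts about \<open>f\<close> are all that is used. First, on a finite set of homomorphisms \<open>f\<close> agrees
  with some evaluation, because the values at the elements of \<open>A\<close> of finitely many homomorphisms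
  form a compatible relation (\<open>locally_evaluation_if_preserves\<close>). Second, by compactness of
  \<open>homs A M\<close> there is a finite \<open>B\<close> such that \<open>f x\<close> depends only on the restriction of \<open>x\<close> to \<open>B\<close>
  (\<open>continuous_finitely_determined\<close>). What has to be found is one element of \<open>A\<close> that serves all
  homomorphisms at once.

  If some homomorphism with \<open>f x\<close> nonzero vanishes outside a finite set, only finitely many
  elements of \<open>A\<close> are candidates, and since every finite set of conditions can be satisfied, one
  candidate satisfies all. A homomorphism can be cut down to zero outside any subset of the
  elements that it sends to letters, so a letter value of \<open>f\<close> leads to this case, and the case
  \<open>f = 0\<close> is trivial. Suppose then that \<open>f\<close> takes states and zero as values, not only zero.
  The homomorphisms on which \<open>f\<close> is a state have a least support, and it is generated by a
  single element \<open>a\<close>: its letters \<open>L\<close> are sent to letters whenever \<open>a\<close> is sent to a state, and its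
  other elements \<open>P\<close> are expressed through \<open>a\<close> and words in \<open>L\<close> (\<open>principal_pattern\<close>).

  On the homomorphisms \<open>y\<close> with \<open>y a\<close> a state the problem becomes one about abelian groups: with
  \<open>W\<close> the free commutative monoid on \<open>L\<close>, a single \<open>w \<in> W\<close> is sought such that \<open>f y\<close> is \<open>y a\<close> acted
  upon by \<open>y w\<close>. Fix finitely many \<open>y\<close>, the set \<open>R\<close>, that represent all restrictions to \<open>{a} \<union> \<Lambda>\<close>,
  where \<open>f y\<close> depends on \<open>y a\<close> and on \<open>y\<close> on the finite set \<open>\<Lambda> \<subseteq> L\<close>. If \<open>w\<close> is right for \<open>R\<close> and of
  the form \<open>l + h z\<close> with \<open>l\<close> over \<open>\<Lambda>\<close> and \<open>h\<close> such that the \<open>h\<close>-th powers of all letters agree on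
  the states \<open>r a\<close>, then it is right for all \<open>y\<close>. If there is no such \<open>w\<close>, then a word \<open>w\<^sub>0\<close> that is
  right for \<open>R\<close> is separated from the words \<open>l + h z\<close>, up to equality on \<open>R\<close>, by a character
  \<open>\<chi>\<close> with values modulo \<open>h\<close> (\<open>separating_character\<close>). This is where letter-affineness enters:
  for letters \<open>\<alpha>\<close> and \<open>\<beta>\<close> it lets every \<open>r \<in> R\<close> be twisted to a homomorphism whose value at a letter \<open>s\<close> acts like \<open>r s\<close> times \<open>(\<alpha> / \<beta>)\<close> to the power \<open>\<chi> s\<close>. The twisted
  homomorphism agrees with \<open>r\<close> on \<open>{a} \<union> \<Lambda>\<close>, so \<open>f\<close> does not distinguish them; but a word that
  is right for all of these finitely many homomorphisms must have \<open>\<chi>\<close>-value divisible by \<open>h\<close>, a contradiction.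
\<close>

section \<open>Characters of finite abelian groups\<close>

text \<open>Multisets are used as words in commuting letters of finite order. In this setting an
  inverse is a positive multiple, so that a subgroup appears as a submonoid that is closed under
  cancellation.\<close>

definition saturated :: "'b multiset set \<Rightarrow> bool" where
  "saturated N \<longleftrightarrow> {#} \<in> N \<and> (\<forall>x\<in>N. \<forall>y\<in>N. x + y \<in> N) \<and>
     (\<forall>x\<in>N. \<forall>y. x + y \<in> N \<longrightarrow> y \<in> N)"

definition additive_mod :: "nat \<Rightarrow> 'b multiset set \<Rightarrow> ('b multiset \<Rightarrow> int) \<Rightarrow> bool" where
  "additive_mod h N \<chi> \<longleftrightarrow> (\<forall>x\<in>N. \<forall>y\<in>N. [\<chi> (x + y) = \<chi> x + \<chi> y] (mod h))"

lemma saturated_empty: "saturated N \<Longrightarrow> {#} \<in> N"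
  and saturated_add: "saturated N \<Longrightarrow> x \<in> N \<Longrightarrow> y \<in> N \<Longrightarrow> x + y \<in> N"
  and saturated_cancel: "saturated N \<Longrightarrow> x \<in> N \<Longrightarrow> x + y \<in> N \<Longrightarrow> y \<in> N"
  unfolding saturated_def by blast+

lemma saturated_repeat:
  assumes "saturated N" "x \<in> N"
  shows "repeat_mset k x \<in> N"
  by (induction k) (simp_all add: assms saturated_empty saturated_add)

lemma additive_mod_repeat:
  assumes "saturated N" "additive_mod h N \<chi>" "x \<in> N"
  shows "[\<chi> (repeat_mset k x) = int k * \<chi> x] (mod h)"
proof (induction k)
  case 0
  have "[\<chi> ({#} + {#}) = \<chi> {#} + \<chi> {#}] (mod h)"
    using assms(2) saturated_empty[OF assms(1)] unfolding additive_mod_def by blast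
  then have "[\<chi> {#} + 0 = \<chi> {#} + \<chi> {#}] (mod h)" by simp
  then have "[0 = \<chi> {#}] (mod h)" by (simp only: cong_add_lcancel)
  then show ?case by (simp add: cong_sym_eq)
next
  case (Suc k)
  have "[\<chi> (x + repeat_mset k x) = \<chi> x + \<chi> (repeat_mset k x)] (mod h)"
    using assms(2,3) saturated_repeat[OF assms(1,3), of k] unfolding additive_mod_def by blast
  moreover have "[\<chi> x + \<chi> (repeat_mset k x) = \<chi> x + int k * \<chi> x] (mod h)"
    using Suc.IH by (rule cong_add[OF cong_refl])
  ultimately have "[\<chi> (x + repeat_mset k x) = \<chi> x + int k * \<chi> x] (mod h)"
    by (rule cong_trans)
  moreover have "\<chi> x + int k * \<chi> x = int (Suc k) * \<chi> x"
    by (simp add: distrib_right)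
  ultimately show ?case by (metis repeat_mset_Suc)
qed

lemma multiple_in_saturated:
  assumes N: "saturated N" and e: "e > 0" "repeat_mset e b \<in> N"
  obtains d :: nat where "d > 0" "\<And>j. repeat_mset j b \<in> N \<longleftrightarrow> d dvd j"
proof -
  define d where "d = (LEAST d. d > 0 \<and> repeat_mset d b \<in> N)"
  have d: "d > 0 \<and> repeat_mset d b \<in> N"
    unfolding d_def by (rule LeastI[of _ e]) (use e in simp)
  have least: "d \<le> j" if "j > 0" "repeat_mset j b \<in> N" for j
    unfolding d_def by (rule Least_le) (use that in simp)
  have "d dvd j" if "repeat_mset j b \<in> N" for j
  proof -
    have "repeat_mset (j div d) (repeat_mset d b) \<in> N"
      by (rule saturated_repeat[OF N]) (use d in blast)
    moreover have "repeat_mset j b = repeat_mset (j div d) (repeat_mset d b) + repeat_mset (j mod d) b"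
      by (simp flip: repeat_mset_distrib)
    ultimately have "repeat_mset (j mod d) b \<in> N"
      using saturated_cancel[OF N] that by metis
    then have "j mod d = 0"
      using least[of "j mod d"] d by (metis mod_less_divisor not_le neq0_conv)
    then show ?thesis by auto
  qed
  moreover have "repeat_mset j b \<in> N" if "d dvd j" for j
    using saturated_repeat[OF N, of "repeat_mset d b"] d that by (metis dvdE mult.commute repeat_mset_right)
  ultimately show thesis using d that by blast
qed

text \<open>One step of the extension of a character to a larger subgroup. The value \<open>t\<close> at the new
  generator \<open>b\<close> is free except that multiples of \<open>b\<close> that already lie in \<open>N\<close> have a prescribed
  value. The generated subgroup is \<open>{x. \<exists>k. x + k b \<in> N}\<close>, as \<open>k\<close> may be increased by multiples of
  \<open>h\<close> to imitate subtraction.\<close>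

lemma extend_character:
  fixes N :: "'b multiset set" and h :: nat and t :: int
  assumes N: "saturated N" and h: "h > 0" and hN: "\<And>w. repeat_mset h w \<in> N"
    and chi: "additive_mod h N \<chi>"
    and t: "\<And>j. repeat_mset j b \<in> N \<Longrightarrow> [\<chi> (repeat_mset j b) = int j * t] (mod h)"
  obtains N' \<chi>' where "saturated N'" "N \<subseteq> N'" "b \<in> N'" "additive_mod h N' \<chi>'"
    "\<And>x. x \<in> N \<Longrightarrow> [\<chi>' x = \<chi> x] (mod h)" "[\<chi>' b = t] (mod h)"
proof -
  define N' where "N' = {x. \<exists>k. x + repeat_mset k b \<in> N}"
  define \<chi>' where "\<chi>' x = (let k = SOME k. x + repeat_mset k b \<in> N in \<chi> (x + repeat_mset k b) - int k * t)" for x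
  have mono: "[\<chi> (x + repeat_mset k b) - int k * t = \<chi> (x + repeat_mset l b) - int l * t] (mod h)"
    if "x + repeat_mset k b \<in> N" "x + repeat_mset l b \<in> N" "k \<le> l" for x k l
  proof -
    have eq: "x + repeat_mset l b = (x + repeat_mset k b) + repeat_mset (l - k) b"
      using that(3) by (simp add: add.assoc flip: repeat_mset_distrib)
    then have in_N: "repeat_mset (l - k) b \<in> N"
      using saturated_cancel[OF N] that by metis
    have "[\<chi> (x + repeat_mset l b) = \<chi> (x + repeat_mset k b) + \<chi> (repeat_mset (l - k) b)] (mod h)"
      using chi that in_N unfolding additive_mod_def eq by blast
    also have "[\<chi> (x + repeat_mset k b) + \<chi> (repeat_mset (l - k) b)
        = \<chi> (x + repeat_mset k b) + int (l - k) * t] (mod h)"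
      by (rule cong_add[OF cong_refl t[OF in_N]])
    finally have "[\<chi> (x + repeat_mset l b) - int l * t = \<chi> (x + repeat_mset k b) + int (l - k) * t - int l * t] (mod h)"
      by (rule cong_diff[OF _ cong_refl])
    then show ?thesis
      using that(3) by (simp add: of_nat_diff algebra_simps cong_sym_eq)
  qed
  have chi': "[\<chi>' x = \<chi> (x + repeat_mset k b) - int k * t] (mod h)"
    if "x + repeat_mset k b \<in> N" for x k
  proof -
    define l where "l = (SOME k. x + repeat_mset k b \<in> N)"
    have "x + repeat_mset l b \<in> N"
      unfolding l_def by (rule someI[of _ k]) (rule that)
    then have "[\<chi> (x + repeat_mset l b) - int l * t = \<chi> (x + repeat_mset k b) - int k * t] (mod h)"
      using mono[of x k l] mono[of x l k] that by (metis cong_sym_eq nat_le_linear)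
    then show ?thesis
      unfolding \<chi>'_def Let_def l_def .
  qed
  have N_sum: "(x + y) + repeat_mset (k + l) b = (x + repeat_mset k b) + (y + repeat_mset l b)" for x y k l
    by (simp add: repeat_mset_distrib ac_simps)
  have hb: "repeat_mset h b \<in> N" by (rule hN)
  have 1: "saturated N'"
    unfolding saturated_def
  proof (intro conjI ballI allI impI)
    show "{#} \<in> N'" using hb unfolding N'_def by auto
  next
    fix x y assume "x \<in> N'" "y \<in> N'"
    then obtain k l where "x + repeat_mset k b \<in> N" "y + repeat_mset l b \<in> N"
      unfolding N'_def by blast
    then have "(x + y) + repeat_mset (k + l) b \<in> N"
      unfolding N_sum by (rule saturated_add[OF N])
    then show "x + y \<in> N'" unfolding N'_def by blast
  next
    fix x y assume "x \<in> N'" "x + y \<in> N'"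
    then obtain k l where kl: "x + repeat_mset k b \<in> N" "x + y + repeat_mset l b \<in> N"
      unfolding N'_def by blast
    have "(x + repeat_mset k b) + (y + repeat_mset (l + (h - 1) * k) b)
        = (x + y + repeat_mset l b) + repeat_mset k (repeat_mset h b)"
      using h by (auto simp: multiset_eq_iff algebra_simps gr0_conv_Suc)
    moreover have "(x + y + repeat_mset l b) + repeat_mset k (repeat_mset h b) \<in> N"
      by (intro saturated_add[OF N] saturated_repeat[OF N] kl hb)
    ultimately have "y + repeat_mset (l + (h - 1) * k) b \<in> N"
      using saturated_cancel[OF N kl(1)] by metis
    then show "y \<in> N'" unfolding N'_def by blast
  qed
  have 2: "N \<subseteq> N'"
  proof
    fix x assume "x \<in> N"
    then have "x + repeat_mset 0 b \<in> N" by simp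
    then show "x \<in> N'" unfolding N'_def by blast
  qed
  have bh: "b + repeat_mset (h - 1) b = repeat_mset h b"
    using h by (metis Suc_diff_1 repeat_mset_Suc)
  have 3: "b \<in> N'"
    using hb unfolding N'_def by (auto simp flip: bh)
  have 4: "additive_mod h N' \<chi>'"
    unfolding additive_mod_def
  proof (intro ballI)
    fix x y assume "x \<in> N'" "y \<in> N'"
    then obtain k l where kl: "x + repeat_mset k b \<in> N" "y + repeat_mset l b \<in> N"
      unfolding N'_def by blast
    then have in_N: "(x + y) + repeat_mset (k + l) b \<in> N"
      unfolding N_sum by (rule saturated_add[OF N])
    have "[\<chi>' (x + y) = \<chi> ((x + y) + repeat_mset (k + l) b) - int (k + l) * t] (mod h)"
      by (rule chi'[OF in_N])
    also have "[\<chi> ((x + y) + repeat_mset (k + l) b) - int (k + l) * t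
       = (\<chi> (x + repeat_mset k b) + \<chi> (y + repeat_mset l b)) - int (k + l) * t] (mod h)"
      unfolding N_sum using chi kl unfolding additive_mod_def by (intro cong_diff cong_refl) blast
    also have "(\<chi> (x + repeat_mset k b) + \<chi> (y + repeat_mset l b)) - int (k + l) * t
       = (\<chi> (x + repeat_mset k b) - int k * t) + (\<chi> (y + repeat_mset l b) - int l * t)"
      by (simp add: algebra_simps)
    also have "[(\<chi> (x + repeat_mset k b) - int k * t) + (\<chi> (y + repeat_mset l b) - int l * t)
       = \<chi>' x + \<chi>' y] (mod h)"
      by (intro cong_add cong_sym[OF chi'] kl)
    finally show "[\<chi>' (x + y) = \<chi>' x + \<chi>' y] (mod h)" .
  qed
  have 5: "[\<chi>' x = \<chi> x] (mod h)" if "x \<in> N" for x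
    using chi'[of x 0] that by simp
  have 6: "[\<chi>' b = t] (mod h)"
  proof -
    have "[\<chi>' b = \<chi> (repeat_mset h b) - int (h - 1) * t] (mod h)"
      using chi'[of b "h - 1", unfolded bh] hb by blast
    also have "[\<chi> (repeat_mset h b) - int (h - 1) * t = int h * t - int (h - 1) * t] (mod h)"
      by (rule cong_diff[OF t[OF hb] cong_refl])
    also have "int h * t - int (h - 1) * t = t"
      using h by (simp add: of_nat_diff algebra_simps)
    finally show ?thesis .
  qed
  show thesis by (rule that[OF 1 2 3 4 5 6])
qed

text \<open>Finite abelian groups have enough characters. The quotient by \<open>N\<^sub>0\<close> has exponent dividing \<open>h\<close>
  and is finite, as \<open>\<kappa>\<close> is finer than the quotient map. A first character on the
  subgroup generated by \<open>v\<close> is nonzero at \<open>v\<close>; a maximal extension of it is defined everywhere,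
  where the image under \<open>\<kappa>\<close> measures the size of the domain.\<close>

lemma separating_character:
  fixes N\<^sub>0 :: "'b multiset set" and \<kappa> :: "'b multiset \<Rightarrow> 'c" and h :: nat
  assumes N0: "saturated N\<^sub>0" and h: "h > 0" and hN: "\<And>w. repeat_mset h w \<in> N\<^sub>0"
    and fin: "finite (range \<kappa>)"
    and \<kappa>: "\<And>x y. \<kappa> x = \<kappa> y \<Longrightarrow> \<exists>z. x + z \<in> N\<^sub>0 \<and> y + z \<in> N\<^sub>0"
    and v: "v \<notin> N\<^sub>0"
  obtains \<chi> where "additive_mod h UNIV \<chi>" "\<And>x. x \<in> N\<^sub>0 \<Longrightarrow> [\<chi> x = 0] (mod h)"
    "\<not> [\<chi> v = 0] (mod h)"
proof -
  define good where "good = (\<lambda>(N, \<chi>). saturated N \<and> N\<^sub>0 \<subseteq> N \<and> v \<in> N \<and> additive_mod h N \<chi> \<and>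
      (\<forall>x\<in>N\<^sub>0. [\<chi> x = 0] (mod h)) \<and> \<not> [\<chi> v = 0] (mod h))"
  have "\<exists>p. good p"
  proof -
    obtain d where d: "d > 0" "\<And>j. repeat_mset j v \<in> N\<^sub>0 \<longleftrightarrow> d dvd j"
      using multiple_in_saturated[OF N0 h hN] by metis
    have "d dvd h" using d(2)[of h] hN by blast
    then obtain m where m: "h = d * m" by blast
    have "repeat_mset 1 v = v" by simp
    then have "d \<noteq> 1" using d(2)[of 1] v by (metis one_dvd)
    have "m > 0" using m h by (cases m) auto
    then have "m * 1 < m * d" using \<open>d \<noteq> 1\<close> d(1) by (intro mult_strict_left_mono) auto
    then have "m < h" unfolding m by (simp only: mult_1_right mult.commute)
    \<comment> \<open>The order of \<open>v\<close> modulo \<open>N\<^sub>0\<close> is \<open>d > 1\<close>, and \<open>m = h / d\<close> is a nonzero value of order \<open>d\<close>.\<close>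
    have t: "[(\<lambda>_. 0) (repeat_mset j v) = int j * int m] (mod h)" if "repeat_mset j v \<in> N\<^sub>0" for j
    proof -
      have "d dvd j" using d(2)[of j] that by blast
      then obtain i where "j = d * i" by blast
      then have "int j * int m = int h * int i" by (simp add: m)
      then have "[int j * int m = 0] (mod h)" by (simp add: cong_0_iff)
      then show ?thesis by (rule cong_sym)
    qed
    obtain N \<chi> where *: "saturated N" "N\<^sub>0 \<subseteq> N" "v \<in> N" "additive_mod h N \<chi>"
      "\<And>x. x \<in> N\<^sub>0 \<Longrightarrow> [\<chi> x = (\<lambda>_. 0) x] (mod h)" "[\<chi> v = m] (mod h)"
      by (rule extend_character[OF N0 h hN _ t]) (auto simp: additive_mod_def)
    have "\<not> [\<chi> v = 0] (mod h)"
    proof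
      assume "[\<chi> v = 0] (mod h)"
      then have "[int m = 0] (mod h)" using *(6) by (metis cong_sym_eq cong_trans)
      then have "h dvd m" by (simp add: cong_0_iff)
      then show False using \<open>m < h\<close> \<open>m > 0\<close> by (meson dvd_imp_le not_le)
    qed
    then have "good (N, \<chi>)" using * unfolding good_def by auto
    then show ?thesis by blast
  qed
  moreover have "card (\<kappa> ` fst p) \<le> card (range \<kappa>)" for p
    by (rule card_mono[OF fin]) auto
  ultimately obtain p where p: "good p" "\<And>q. good q \<Longrightarrow> card (\<kappa> ` fst q) \<le> card (\<kappa> ` fst p)"
    using ex_has_greatest_nat[of good _ "\<lambda>p. card (\<kappa> ` fst p)" "Suc (card (range \<kappa>))"]
    by (metis le_imp_less_Suc)
  obtain N \<chi> where p_eq: "p = (N, \<chi>)" by fastforce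
  have N: "saturated N" "N\<^sub>0 \<subseteq> N" "v \<in> N" "additive_mod h N \<chi>"
      "\<And>x. x \<in> N\<^sub>0 \<Longrightarrow> [\<chi> x = 0] (mod h)" "\<not> [\<chi> v = 0] (mod h)"
    using p(1) unfolding good_def p_eq by auto
  have hN': "repeat_mset h w \<in> N" for w using hN N(2) by blast
  have "b \<in> N" for b
  proof (rule ccontr)
    assume b: "b \<notin> N"
    obtain d where d: "d > 0" "\<And>j. repeat_mset j b \<in> N \<longleftrightarrow> d dvd j"
      using multiple_in_saturated[OF N(1) h hN'] by metis
    have "d dvd h" using d(2)[of h] hN' by blast
    then obtain m where m: "h = d * m" by blast
    have db: "repeat_mset d b \<in> N" using d(2)[of d] by simp
    \<comment> \<open>The value at \<open>d b\<close> is divisible by \<open>d\<close> because its \<open>(h / d)\<close>-fold vanishes modulo \<open>h\<close>.\<close>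
    have "[\<chi> (repeat_mset m (repeat_mset d b)) = int m * \<chi> (repeat_mset d b)] (mod h)"
      by (rule additive_mod_repeat[OF N(1,4) db])
    moreover have "[\<chi> (repeat_mset m (repeat_mset d b)) = 0] (mod h)"
      using N(5)[OF hN[of b]] m by (simp add: mult.commute)
    ultimately have "[int m * \<chi> (repeat_mset d b) = 0] (mod h)"
      by (metis cong_sym_eq cong_trans)
    then have "int m * int d dvd int m * \<chi> (repeat_mset d b)"
      by (simp add: cong_0_iff m mult.commute)
    then have "int d dvd \<chi> (repeat_mset d b)" using m h by simp
    then obtain t where t: "\<chi> (repeat_mset d b) = int d * t" by blast
    have t': "[\<chi> (repeat_mset j b) = int j * t] (mod h)" if "repeat_mset j b \<in> N" for j
    proof -
      have "d dvd j" using d(2)[of j] that by blast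
      then obtain i where i: "j = d * i" by blast
      have "[\<chi> (repeat_mset i (repeat_mset d b)) = int i * \<chi> (repeat_mset d b)] (mod h)"
        by (rule additive_mod_repeat[OF N(1,4) db])
      then show ?thesis unfolding i t by (simp add: ac_simps)
    qed
    obtain N' \<chi>' where *: "saturated N'" "N \<subseteq> N'" "b \<in> N'" "additive_mod h N' \<chi>'"
      "\<And>x. x \<in> N \<Longrightarrow> [\<chi>' x = \<chi> x] (mod h)" "[\<chi>' b = t] (mod h)"
      by (rule extend_character[OF N(1) h hN' N(4) t']) auto
    have "good (N', \<chi>')"
      using * N unfolding good_def by (auto intro: cong_trans cong_sym) (meson cong_sym cong_trans subsetD)+
    then have "card (\<kappa> ` N') \<le> card (\<kappa> ` N)" using p(2) p_eq by force
    moreover have "\<kappa> ` N \<subset> \<kappa> ` N'"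
    proof -
      have "\<kappa> b \<notin> \<kappa> ` N"
      proof
        assume "\<kappa> b \<in> \<kappa> ` N"
        then obtain x where x: "x \<in> N" "\<kappa> x = \<kappa> b" by auto
        then obtain z where "x + z \<in> N\<^sub>0" "b + z \<in> N\<^sub>0" using \<kappa> by blast
        then have "x + z \<in> N" "z + b \<in> N" using N(2) by (auto simp: add.commute)
        then show False using saturated_cancel[OF N(1)] saturated_add[OF N(1)] x(1) b by metis
      qed
      then show ?thesis using *(2,3) by blast
    qed
    moreover have "finite (\<kappa> ` N')" using fin by (rule rev_finite_subset) auto
    ultimately show False using psubset_card_mono[of "\<kappa> ` N'" "\<kappa> ` N"] by simp
  qed
  then have "N = UNIV" by blast
  then show thesis using that N(4-6) by blast
qed

section \<open>The action of multisets of letters\<close>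

text \<open>Components do not occur in these conditions. Since the letters commute, a relation between
  words that holds at one state holds at all states that can be reached from it, so it is enough
  to require letter-affineness at each state separately.\<close>

locale affine_letters =
  fixes M :: "'a automatic"
  assumes automatic: "automatic_algebra M"
    and finite_univ: "finite (univ M)"
    and opn_state: "q \<in> states M \<Longrightarrow> a \<in> letters M \<Longrightarrow> opn M q a \<in> states M"
    and opn_inj: "q \<in> states M \<Longrightarrow> q' \<in> states M \<Longrightarrow> a \<in> letters M \<Longrightarrow>
      opn M q a = opn M q' a \<Longrightarrow> q = q'"
    and opn_commute: "q \<in> states M \<Longrightarrow> a \<in> letters M \<Longrightarrow> b \<in> letters M \<Longrightarrow>
      opn M (opn M q a) b = opn M (opn M q b) a"
    and opn_affine: "q \<in> states M \<Longrightarrow> a \<in> letters M \<Longrightarrow> b \<in> letters M \<Longrightarrow> c \<in> letters M \<Longrightarrow>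
      \<exists>d\<in>letters M. opn M (opn M q b) d = opn M (opn M q a) c"
begin

lemma univ_eq: "univ M = states M \<union> letters M \<union> {zero M}"
  and states_letters_disjoint: "q \<in> states M \<Longrightarrow> q \<notin> letters M"
  and zero_not_state: "zero M \<notin> states M"
  and zero_not_letter: "zero M \<notin> letters M"
  using automatic unfolding automatic_algebra_def by auto

lemma finite_states: "finite (states M)" and finite_letters: "finite (letters M)"
  using finite_univ univ_eq by auto

lemma opn_zero:
  assumes "x \<in> univ M" "y \<in> univ M" "\<not> (x \<in> states M \<and> y \<in> letters M)"
  shows "opn M x y = zero M"
  using automatic assms unfolding automatic_algebra_def by blast

lemma opn_not_letter: "x \<in> univ M \<Longrightarrow> y \<in> univ M \<Longrightarrow> opn M x y \<notin> letters M"
  using opn_zero opn_state states_letters_disjoint zero_not_letter by metis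

lemma opn_state_iff:
  "x \<in> univ M \<Longrightarrow> y \<in> univ M \<Longrightarrow> opn M x y \<in> states M \<longleftrightarrow> x \<in> states M \<and> y \<in> letters M"
  using opn_zero opn_state zero_not_state by metis

text \<open>Extending the action of letters by the identity to all elements makes it total and
  commuting on the whole type, so that multisets act as well. Elements that are not letters act
  trivially.\<close>

definition step :: "'a \<Rightarrow> 'a \<Rightarrow> 'a" where
  "step a q = (if q \<in> states M \<and> a \<in> letters M then opn M q a else q)"

definition act :: "'a multiset \<Rightarrow> 'a \<Rightarrow> 'a" where
  "act m q = fold_mset step q m"

sublocale step: comp_fun_commute step
  by standard (auto simp: fun_eq_iff step_def opn_state opn_commute)

lemma act_empty [simp]: "act {#} q = q"
  by (simp add: act_def)

lemma act_add_mset [simp]: "act (add_mset a m) q = step a (act m q)"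
  by (simp add: act_def)

lemma act_union: "act (m + n) q = act m (act n q)"
  unfolding act_def by (metis add.commute step.fold_mset_union)

lemma act_commute: "act m (act n q) = act n (act m q)"
  by (metis act_union add.commute)

lemma step_state_iff [simp]: "step a q \<in> states M \<longleftrightarrow> q \<in> states M"
  by (auto simp: step_def opn_state)

lemma act_state_iff [simp]: "act m q \<in> states M \<longleftrightarrow> q \<in> states M"
  by (induction m) auto

lemma step_cancel [simp]: "step a q = step a q' \<longleftrightarrow> q = q'"
proof
  assume eq: "step a q = step a q'"
  then have "q \<in> states M \<longleftrightarrow> q' \<in> states M" by (metis step_state_iff)
  with eq show "q = q'" unfolding step_def by (auto split: if_splits dest: opn_inj)
qed simp

lemma act_cancel [simp]: "act m q = act m q' \<longleftrightarrow> q = q'"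
  by (induction m) auto

lemma act_replicate: "act (replicate_mset k a) q = (step a ^^ k) q"
  by (induction k) auto

lemma act_replicate_add:
  "act (replicate_mset (j + k) b) q = act (replicate_mset j b) (act (replicate_mset k b) q)"
  by (simp add: act_replicate funpow_add)

lemma step_power_id: "\<exists>n>0. step a ^^ n = id"
proof -
  have "inj_on (step a) (states M)"
    by (rule inj_onI) simp
  then have "bij_betw (step a) (states M) (states M)"
    unfolding bij_betw_def using finite_states
    by (intro conjI endo_inj_surj) auto
  then have "step a permutes states M"
    by (rule bij_imp_permutes) (simp add: step_def)
  then have "permutation (step a)"
    using finite_states permutation_permutes by blast
  then show ?thesis
    using permutation_is_nilpotent by blast
qed

lemma exponent_exists: "\<exists>e>0. \<forall>m q. act (repeat_mset e m) q = q"
proof -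
  obtain n where n: "\<And>a. n a > 0" "\<And>a. step a ^^ n a = id"
    using step_power_id by metis
  define e where "e = (\<Prod>a\<in>letters M. n a)"
  have "e > 0" unfolding e_def using n(1) by (simp add: prod_pos)
  have one: "act (replicate_mset e a) q = q" for a q
  proof (cases "a \<in> letters M")
    case True
    then have "n a dvd e" unfolding e_def using finite_letters by (simp add: dvd_prodI)
    then obtain k where "e = n a * k" by blast
    then have "step a ^^ e = (step a ^^ n a) ^^ k" by (simp only: funpow_mult)
    also have "\<dots> = id" unfolding n(2) by (induction k) auto
    finally have "step a ^^ e = id" .
    then show ?thesis by (simp add: act_replicate)
  next
    case False
    have "act (replicate_mset k a) q = q" for k
      by (induction k) (use False in \<open>auto simp: step_def\<close>)
    then show ?thesis .
  qed
  have "act (repeat_mset e m) q = q" for m q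
    by (induction m arbitrary: q) (auto simp: act_union one)
  then show ?thesis using \<open>e > 0\<close> by blast
qed

text \<open>A common exponent of all permutations, used to express inverses as multiples.\<close>

definition period :: nat where
  "period = (SOME e. e > 0 \<and> (\<forall>m q. act (repeat_mset e m) q = q))"

lemma period_pos: "period > 0" and act_period [simp]: "act (repeat_mset period m) q = q"
  using someI_ex[OF exponent_exists] unfolding period_def by auto

lemma act_inverse: "act (repeat_mset (period - 1) m) (act m q) = q"
proof -
  have "act (m + repeat_mset (period - 1) m) q = q"
    using period_pos by (metis Suc_diff_1 act_period repeat_mset_Suc)
  then show ?thesis by (simp add: act_union act_commute)
qed

text \<open>Iterated letter-affineness: \<open>(a / b)^k c\<close> acts at \<open>q\<close> like a single letter.\<close>

lemma affine_power:
  assumes "q \<in> states M" "a \<in> letters M" "b \<in> letters M" "c \<in> letters M"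
  shows "\<exists>d\<in>letters M. step d (act (replicate_mset k b) q) = step c (act (replicate_mset k a) q)"
proof (induction k)
  case 0
  then show ?case using assms by auto
next
  case (Suc k)
  then obtain d where d: "d \<in> letters M"
    "step d (act (replicate_mset k b) q) = step c (act (replicate_mset k a) q)" by blast
  let ?q = "act (replicate_mset k b) q"
  have "?q \<in> states M" using assms by simp
  then obtain d' where d': "d' \<in> letters M" "opn M (opn M ?q b) d' = opn M (opn M ?q a) d"
    using opn_affine assms d(1) by blast
  then have "step d' (step b ?q) = step d (step a ?q)"
    using \<open>?q \<in> states M\<close> assms d(1) by (simp add: step_def opn_state)
  also have "\<dots> = step a (step d ?q)" by (rule step.fun_left_comm)
  also have "\<dots> = step c (step a (act (replicate_mset k a) q))"
    unfolding d(2) by (rule step.fun_left_comm)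
  finally show ?case using d'(1) by auto
qed

end

section \<open>Patterns of homomorphisms and the least pattern\<close>

text \<open>The two properties of \<open>f\<close> that follow from the preservation of compatible relations and from
  continuity.\<close>

locale local_evaluation = affine_letters M
  for M :: "'a automatic" +
  fixes A :: "'b magma" and f :: "('b \<Rightarrow> 'a) \<Rightarrow> 'a" and B :: "'b set"
  assumes magma: "is_magma A"
    and locally: "finite X \<Longrightarrow> X \<subseteq> homs A M \<Longrightarrow> \<exists>b\<in>univ A. \<forall>x\<in>X. f x = x b"
    and finite_B: "finite B"
    and B_univ: "B \<subseteq> univ A"
    and determined: "x \<in> homs A M \<Longrightarrow> y \<in> homs A M \<Longrightarrow> (\<And>b. b \<in> B \<Longrightarrow> x b = y b) \<Longrightarrow> f x = f y"
begin

lemma opn_closed: "x \<in> univ A \<Longrightarrow> y \<in> univ A \<Longrightarrow> opn A x y \<in> univ A"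
  using magma unfolding is_magma_def subuniverse_def by blast

lemma hom_univ: "x \<in> homs A M \<Longrightarrow> b \<in> univ A \<Longrightarrow> x b \<in> univ M"
  and hom_opn: "x \<in> homs A M \<Longrightarrow> b \<in> univ A \<Longrightarrow> c \<in> univ A \<Longrightarrow> x (opn A b c) = opn M (x b) (x c)"
  unfolding homs_def by auto

lemma hom_opn_state_iff:
  "x \<in> homs A M \<Longrightarrow> b \<in> univ A \<Longrightarrow> c \<in> univ A \<Longrightarrow>
    x (opn A b c) \<in> states M \<longleftrightarrow> x b \<in> states M \<and> x c \<in> letters M"
  by (simp add: hom_opn hom_univ opn_state_iff)

lemma hom_opn_step:
  "x \<in> homs A M \<Longrightarrow> b \<in> univ A \<Longrightarrow> c \<in> univ A \<Longrightarrow> x b \<in> states M \<Longrightarrow> x c \<in> letters M \<Longrightarrow>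
    x (opn A b c) = step (x c) (x b)"
  by (simp add: hom_opn step_def)

lemma locally':
  assumes "finite X" "X \<subseteq> homs A M"
  obtains b where "b \<in> univ A" "\<And>x. x \<in> X \<Longrightarrow> f x = x b"
  using locally[OF assms] by blast

text \<open>What the preimages of the states and of the letters under a homomorphism into \<open>M\<close> satisfy
  as sets, expressed by the multiplication of \<open>A\<close> alone. A homomorphism may be replaced by zero outside any smaller pattern.\<close>

definition pattern :: "'b set \<Rightarrow> 'b set \<Rightarrow> bool" where
  "pattern P L \<longleftrightarrow> P \<subseteq> univ A \<and> L \<subseteq> univ A \<and> P \<inter> L = {} \<and>
     (\<forall>p\<in>univ A. \<forall>s\<in>univ A. (opn A p s \<in> P \<longleftrightarrow> p \<in> P \<and> s \<in> L) \<and> opn A p s \<notin> L)"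

definition cut :: "('b \<Rightarrow> 'a) \<Rightarrow> 'b set \<Rightarrow> 'b set \<Rightarrow> 'b \<Rightarrow> 'a" where
  "cut y P L = (\<lambda>b\<in>univ A. if b \<in> P \<union> L then y b else zero M)"

definition state_part :: "('b \<Rightarrow> 'a) \<Rightarrow> 'b set" where
  "state_part x = {b \<in> univ A. x b \<in> states M}"

definition letter_part :: "('b \<Rightarrow> 'a) \<Rightarrow> 'b set" where
  "letter_part x = {b \<in> univ A. x b \<in> letters M}"

lemma patternD:
  assumes "pattern P L" "p \<in> univ A" "s \<in> univ A"
  shows "opn A p s \<in> P \<longleftrightarrow> p \<in> P \<and> s \<in> L" "opn A p s \<notin> L"
  using assms unfolding pattern_def by blast+

lemma pattern_univ: "pattern P L \<Longrightarrow> P \<subseteq> univ A" "pattern P L \<Longrightarrow> L \<subseteq> univ A"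
  unfolding pattern_def by blast+

lemma pattern_INT:
  assumes i: "i \<in> I" and pat: "\<And>i. i \<in> I \<Longrightarrow> pattern (P i) (L i)"
  shows "pattern (\<Inter>i\<in>I. P i) (\<Inter>i\<in>I. L i)"
  unfolding pattern_def
proof (intro conjI ballI)
  show "(\<Inter>i\<in>I. P i) \<subseteq> univ A" "(\<Inter>i\<in>I. L i) \<subseteq> univ A" "(\<Inter>i\<in>I. P i) \<inter> (\<Inter>i\<in>I. L i) = {}"
    using i pat[OF i] unfolding pattern_def by blast+
  fix p s assume "p \<in> univ A" "s \<in> univ A"
  note * = patternD[OF pat this]
  show "opn A p s \<in> (\<Inter>i\<in>I. P i) \<longleftrightarrow> p \<in> (\<Inter>i\<in>I. P i) \<and> s \<in> (\<Inter>i\<in>I. L i)"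
    using *(1) by auto
  show "opn A p s \<notin> (\<Inter>i\<in>I. L i)"
    using *(2)[OF i] i by blast
qed

lemma pattern_of_hom: "x \<in> homs A M \<Longrightarrow> pattern (state_part x) (letter_part x)"
  unfolding pattern_def state_part_def letter_part_def
  by (auto simp: opn_closed hom_opn_state_iff states_letters_disjoint)
     (simp add: hom_opn hom_univ opn_not_letter)

lemma cut_in_homs:
  assumes P: "pattern P L"
    and st: "\<And>p. p \<in> P \<Longrightarrow> y p \<in> states M" and lt: "\<And>s. s \<in> L \<Longrightarrow> y s \<in> letters M"
    and hom: "\<And>p s. p \<in> P \<Longrightarrow> s \<in> L \<Longrightarrow> y (opn A p s) = opn M (y p) (y s)"
  shows "cut y P L \<in> homs A M"
proof -
  have univ: "cut y P L b \<in> univ M" if "b \<in> univ A" for b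
    using that st lt unfolding cut_def univ_eq by auto
  have "cut y P L (opn A p s) = opn M (cut y P L p) (cut y P L s)"
    if "p \<in> univ A" "s \<in> univ A" for p s
  proof (cases "p \<in> P \<and> s \<in> L")
    case True
    then have "opn A p s \<in> P" using P that unfolding pattern_def by blast
    then show ?thesis using True that hom opn_closed by (simp add: cut_def)
  next
    case False
    then have "opn A p s \<notin> P \<union> L" using P that unfolding pattern_def by blast
    moreover have "\<not> (cut y P L p \<in> states M \<and> cut y P L s \<in> letters M)"
      using False that st lt states_letters_disjoint zero_not_state zero_not_letter
      unfolding cut_def by (auto split: if_splits)
    ultimately show ?thesis
      using univ that opn_closed by (simp add: opn_zero cut_def)
  qed
  with univ show ?thesis
    unfolding homs_def by (auto simp: cut_def)
qed

lemma cut_hom: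
  assumes "x \<in> homs A M" "pattern P L" "P \<subseteq> state_part x" "L \<subseteq> letter_part x"
  shows "cut x P L \<in> homs A M"
proof (rule cut_in_homs[OF assms(2)])
  show "x (opn A p s) = opn M (x p) (x s)" if "p \<in> P" "s \<in> L" for p s
    by (rule hom_opn[OF assms(1)]) (use that assms in \<open>auto simp: state_part_def letter_part_def\<close>)
qed (use assms in \<open>auto simp: state_part_def letter_part_def\<close>)

lemma cut_parts:
  assumes "pattern P L" "\<And>p. p \<in> P \<Longrightarrow> y p \<in> states M" "\<And>s. s \<in> L \<Longrightarrow> y s \<in> letters M"
  shows "state_part (cut y P L) = P" "letter_part (cut y P L) = L"
  using assms zero_not_state zero_not_letter states_letters_disjoint
  unfolding pattern_def state_part_def letter_part_def cut_def by (auto split: if_splits)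

text \<open>An element at which all of finitely many evaluations have the right value, one of them being
  that of \<open>x\<close>, lies in the finite support of \<open>x\<close>. If each element of the support were wrong for
  some homomorphism, these homomorphisms together with \<open>x\<close> would have no common element.\<close>

lemma evaluation_if_finite_support:
  assumes x: "x \<in> homs A M" "f x \<noteq> zero M" and fin: "finite {b \<in> univ A. x b \<noteq> zero M}"
  shows "evaluation A M f"
proof (rule ccontr)
  assume "\<not> evaluation A M f"
  then obtain y where y: "\<And>b. b \<in> univ A \<Longrightarrow> y b \<in> homs A M \<and> f (y b) \<noteq> y b b"
    unfolding evaluation_def by metis
  let ?X = "insert x (y ` {b \<in> univ A. x b \<noteq> zero M})"
  obtain b where b: "b \<in> univ A" "\<And>z. z \<in> ?X \<Longrightarrow> f z = z b"
    by (rule locally'[of ?X]) (use fin x y in auto)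
  then have "f (y b) = y b b" using x(2) by auto
  with y b(1) show False by blast
qed

text \<open>Products are never sent to letters, so no condition links the elements that are.\<close>

lemma pattern_letters_only:
  assumes "x \<in> homs A M" "L \<subseteq> letter_part x"
  shows "pattern {} L"
  using pattern_of_hom[OF assms(1)] assms(2) unfolding pattern_def by blast

lemma evaluation_if_letter_value:
  assumes x: "x \<in> homs A M" and fx: "f x \<in> letters M"
  shows "evaluation A M f"
proof -
  let ?L = "letter_part x"
  define y where "y = cut x {} ?L"
  define z where "z = cut x {} (?L \<inter> B)"
  have y: "y \<in> homs A M" and z: "z \<in> homs A M"
    unfolding y_def z_def by (auto intro!: cut_hom x pattern_letters_only)
  obtain b where b: "b \<in> univ A" "f x = x b" "f y = y b"
    by (rule locally'[of "{x, y}"]) (use x y in auto)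
  have "f z = f y"
    by (rule determined[OF z y]) (use B_univ in \<open>auto simp: z_def y_def cut_def\<close>)
  also have "\<dots> = x b"
    unfolding b(3) using b(1,2) fx by (simp add: y_def cut_def letter_part_def)
  finally have "f z \<noteq> zero M" using fx b(2) zero_not_letter by metis
  moreover have "{b \<in> univ A. z b \<noteq> zero M} \<subseteq> B"
    by (auto simp: z_def cut_def split: if_splits)
  ultimately show ?thesis
    using evaluation_if_finite_support[OF z] finite_B finite_subset by blast
qed

text \<open>A square is sent to zero by every homomorphism, since no element is both a state and a letter.\<close>

lemma evaluation_if_zero:
  assumes "\<And>x. x \<in> homs A M \<Longrightarrow> f x = zero M"
  shows "evaluation A M f"
proof -
  obtain b where b: "b \<in> univ A" by (rule locally'[of "{}"]) auto
  have "x (opn A b b) = zero M" if "x \<in> homs A M" for x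
    using that b hom_opn[OF that b b] hom_univ[OF that b] opn_zero[of "x b" "x b"]
      states_letters_disjoint by metis
  then show ?thesis unfolding evaluation_def using assms opn_closed[OF b b] by metis
qed

definition word :: "'b \<Rightarrow> 'b list \<Rightarrow> 'b" where
  "word a ls = foldl (opn A) a ls"

lemma word_univ: "a \<in> univ A \<Longrightarrow> set ls \<subseteq> univ A \<Longrightarrow> word a ls \<in> univ A"
  unfolding word_def by (induction ls arbitrary: a) (auto simp: opn_closed)

lemma hom_word_state_iff:
  assumes y: "y \<in> homs A M" and a: "a \<in> univ A" and ls: "set ls \<subseteq> univ A"
  shows "y (word a ls) \<in> states M \<longleftrightarrow> y a \<in> states M \<and> y ` set ls \<subseteq> letters M"
  using a ls
proof (induction ls arbitrary: a)
  case (Cons s ls)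
  have "y (word (opn A a s) ls) \<in> states M \<longleftrightarrow> y (opn A a s) \<in> states M \<and> y ` set ls \<subseteq> letters M"
    by (rule Cons.IH) (use Cons.prems opn_closed in auto)
  then show ?case using Cons.prems y by (auto simp: word_def hom_opn_state_iff)
qed (simp add: word_def)

lemma hom_word_act:
  assumes y: "y \<in> homs A M" and a: "a \<in> univ A" and ls: "set ls \<subseteq> univ A"
    and st: "y a \<in> states M" "y ` set ls \<subseteq> letters M"
  shows "y (word a ls) = act (image_mset y (mset ls)) (y a)"
  using a ls st
proof (induction ls arbitrary: a)
  case (Cons s ls)
  have eq: "y (opn A a s) = step (y s) (y a)"
    using Cons.prems y by (auto intro: hom_opn_step)
  have "y (word (opn A a s) ls) = act (image_mset y (mset ls)) (y (opn A a s))"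
    by (rule Cons.IH) (use Cons.prems opn_closed eq in auto)
  also have "\<dots> = step (y s) (act (image_mset y (mset ls)) (y a))"
    using act_commute[of "image_mset y (mset ls)" "{#y s#}"] by (simp add: eq)
  finally show ?case by (simp add: word_def)
qed (simp add: word_def)

lemma hom_word_zero:
  assumes y: "y \<in> homs A M" and a: "a \<in> univ A" and ls: "set ls \<subseteq> univ A" "ls \<noteq> []"
    and nst: "y a \<notin> states M"
  shows "y (word a ls) = zero M"
proof -
  have "y (word (word a ks) [s]) = zero M"
    if "ls = ks @ [s]" for ks s
  proof -
    have ks: "word a ks \<in> univ A" "s \<in> univ A" using that ls a by (auto intro: word_univ)
    moreover have "y (word a ks) \<notin> states M"
      using hom_word_state_iff[OF y a] nst that ls by auto
    ultimately show ?thesis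
      using y by (simp add: word_def hom_opn hom_univ opn_zero)
  qed
  moreover obtain ks s where "ls = ks @ [s]" using ls(2) by (metis rev_exhaust)
  ultimately show ?thesis by (auto simp: word_def)
qed

text \<open>The elements \<open>p\<close> that are connected with \<open>a\<close> by letters in \<open>L\<close>, in the sense that
  \<open>p u\<close> and \<open>a w\<close> are equal for words \<open>u\<close>, \<open>w\<close> over \<open>L\<close>. Equality is tested only through
  homomorphisms that send \<open>a\<close> to a state and the entries of \<open>u\<close> and \<open>w\<close> to letters.\<close>

definition linked :: "'b set \<Rightarrow> 'b set \<Rightarrow> 'b \<Rightarrow> 'b set" where
  "linked P L a = {p \<in> P. \<exists>u w. set_mset u \<subseteq> L \<and> set_mset w \<subseteq> L \<and>
     (\<forall>y\<in>homs A M. y ` set_mset (u + w) \<subseteq> letters M \<and> y a \<in> states M \<longrightarrow>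
        y p \<in> states M \<and> act (image_mset y u) (y p) = act (image_mset y w) (y a))}"

lemma linkedI:
  assumes "p \<in> P" "set_mset u \<subseteq> L" "set_mset w \<subseteq> L"
    "\<And>y. y \<in> homs A M \<Longrightarrow> y ` set_mset u \<subseteq> letters M \<Longrightarrow> y ` set_mset w \<subseteq> letters M \<Longrightarrow>
      y a \<in> states M \<Longrightarrow>
      y p \<in> states M \<and> act (image_mset y u) (y p) = act (image_mset y w) (y a)"
  shows "p \<in> linked P L a"
  unfolding linked_def mem_Collect_eq
  using assms by (intro conjI exI[of _ u] exI[of _ w] ballI impI) (simp_all add: image_Un)

lemma linkedE:
  assumes "p \<in> linked P L a"
  obtains u w where "p \<in> P" "set_mset u \<subseteq> L" "set_mset w \<subseteq> L"
    "\<forall>y\<in>homs A M. y ` set_mset u \<subseteq> letters M \<longrightarrow> y ` set_mset w \<subseteq> letters M \<longrightarrow> y a \<in> states M \<longrightarrow>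
      y p \<in> states M \<and> act (image_mset y u) (y p) = act (image_mset y w) (y a)"
proof -
  obtain u w where "p \<in> P" "set_mset u \<subseteq> L" "set_mset w \<subseteq> L"
    and *: "\<forall>y\<in>homs A M. y ` set_mset (u + w) \<subseteq> letters M \<and> y a \<in> states M \<longrightarrow>
      y p \<in> states M \<and> act (image_mset y u) (y p) = act (image_mset y w) (y a)"
    using assms unfolding linked_def by blast
  then show thesis
    by (intro that[of u w]) (simp_all add: image_Un)
qed

lemma linked_refl: "a \<in> P \<Longrightarrow> a \<in> linked P L a"
  by (rule linkedI[of _ _ "{#}" _ "{#}"]) auto

text \<open>A letter that divides a linked element is sent to a letter whenever \<open>a\<close> is sent to a state
  and \<open>L\<close> to letters. Hence \<open>L\<close> and its linked elements form a pattern if \<open>L\<close>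
  contains all elements of \<open>L\<^sub>0\<close> with this property.\<close>

lemma linked_pattern:
  assumes pat: "pattern P L\<^sub>0" and L: "L \<subseteq> L\<^sub>0"
    and closed: "\<And>s. s \<in> L\<^sub>0 \<Longrightarrow> (\<And>y. y \<in> homs A M \<Longrightarrow> y a \<in> states M \<Longrightarrow>
      y ` L \<subseteq> letters M \<Longrightarrow> y s \<in> letters M) \<Longrightarrow> s \<in> L"
  shows "pattern (linked P L a) L"
  unfolding pattern_def
proof (intro conjI ballI)
  show "linked P L a \<subseteq> univ A" "L \<subseteq> univ A" "linked P L a \<inter> L = {}"
    using pat L unfolding pattern_def linked_def by blast+
  fix p s assume ps: "p \<in> univ A" "s \<in> univ A"
  show "opn A p s \<notin> L"
    using patternD(2)[OF pat ps] L by blast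
  show "opn A p s \<in> linked P L a \<longleftrightarrow> p \<in> linked P L a \<and> s \<in> L"
  proof
    assume "opn A p s \<in> linked P L a"
    then obtain u w where uw: "opn A p s \<in> P" "set_mset u \<subseteq> L" "set_mset w \<subseteq> L"
      and all: "\<forall>y\<in>homs A M. y ` set_mset u \<subseteq> letters M \<longrightarrow> y ` set_mset w \<subseteq> letters M \<longrightarrow>
        y a \<in> states M \<longrightarrow> y (opn A p s) \<in> states M \<and>
        act (image_mset y u) (y (opn A p s)) = act (image_mset y w) (y a)"
      by (rule linkedE) (rule that)
    have PL: "p \<in> P" "s \<in> L\<^sub>0" using uw(1) patternD(1)[OF pat ps] by auto
    have s: "s \<in> L"
    proof (rule closed[OF PL(2)])
      fix y assume y: "y \<in> homs A M" "y a \<in> states M" "y ` L \<subseteq> letters M"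
      then have "y ` set_mset u \<subseteq> letters M" "y ` set_mset w \<subseteq> letters M"
        using uw by blast+
      then have "y (opn A p s) \<in> states M" using all y by blast
      then show "y s \<in> letters M" using hom_opn_state_iff[OF y(1) ps] by blast
    qed
    have "p \<in> linked P L a"
    proof (rule linkedI[OF PL(1), of "add_mset s u" _ w])
      fix y assume y: "y \<in> homs A M" "y ` set_mset (add_mset s u) \<subseteq> letters M"
        "y ` set_mset w \<subseteq> letters M" "y a \<in> states M"
      have "y ` set_mset u \<subseteq> letters M" using y(2) by simp
      then have y': "y (opn A p s) \<in> states M"
        "act (image_mset y u) (y (opn A p s)) = act (image_mset y w) (y a)"
        using all y(1,3,4) by blast+
      then have "y p \<in> states M" "y s \<in> letters M" using hom_opn_state_iff[OF y(1) ps] by auto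
      moreover from this have "y (opn A p s) = act {#y s#} (y p)"
        using hom_opn_step[OF y(1) ps] by simp
      ultimately show "y p \<in> states M \<and>
          act (image_mset y (add_mset s u)) (y p) = act (image_mset y w) (y a)"
        using y'(2) act_commute[of "image_mset y u" "{#y s#}" "y p"] by simp
    qed (use uw s in auto)
    with s show "p \<in> linked P L a \<and> s \<in> L" by blast
  next
    assume *: "p \<in> linked P L a \<and> s \<in> L"
    then have "p \<in> linked P L a" by blast
    then obtain u w where uw: "p \<in> P" "set_mset u \<subseteq> L" "set_mset w \<subseteq> L"
      and all: "\<forall>y\<in>homs A M. y ` set_mset u \<subseteq> letters M \<longrightarrow> y ` set_mset w \<subseteq> letters M \<longrightarrow>
        y a \<in> states M \<longrightarrow> y p \<in> states M \<and>
        act (image_mset y u) (y p) = act (image_mset y w) (y a)"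
      by (rule linkedE) (rule that)
    show "opn A p s \<in> linked P L a"
    proof (rule linkedI[of _ _ u _ "add_mset s w"])
      show "opn A p s \<in> P" using * uw(1) L patternD(1)[OF pat ps] by blast
      fix y assume y: "y \<in> homs A M" "y ` set_mset u \<subseteq> letters M"
        "y ` set_mset (add_mset s w) \<subseteq> letters M" "y a \<in> states M"
      have "y ` set_mset w \<subseteq> letters M" using y(3) by simp
      then have y': "y p \<in> states M" "act (image_mset y u) (y p) = act (image_mset y w) (y a)"
        using all y(1,2,4) by blast+
      have "y s \<in> letters M" using y by auto
      then have "y (opn A p s) \<in> states M" "y (opn A p s) = act {#y s#} (y p)"
        using hom_opn_state_iff[OF y(1) ps] hom_opn_step[OF y(1) ps] y' by auto
      then show "y (opn A p s) \<in> states M \<and>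
          act (image_mset y u) (y (opn A p s)) = act (image_mset y (add_mset s w)) (y a)"
        using y'(2) act_commute[of "image_mset y u" "{#y s#}" "y p"] by simp
    qed (use uw * in auto)
  qed
qed

lemma pattern_UN:
  assumes pat: "\<And>i. i \<in> I \<Longrightarrow> pattern (P i) L" and L: "pattern {} L"
  shows "pattern (\<Union>i\<in>I. P i) L"
  unfolding pattern_def
proof (intro conjI ballI)
  show "(\<Union>i\<in>I. P i) \<subseteq> univ A" "L \<subseteq> univ A" "(\<Union>i\<in>I. P i) \<inter> L = {}"
    using pat L unfolding pattern_def by blast+
  fix p s assume ps: "p \<in> univ A" "s \<in> univ A"
  show "opn A p s \<notin> L" by (rule patternD[OF L ps])
  show "opn A p s \<in> (\<Union>i\<in>I. P i) \<longleftrightarrow> p \<in> (\<Union>i\<in>I. P i) \<and> s \<in> L"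
    using patternD(1)[OF pat ps] by auto
qed

text \<open>The homomorphisms with a state as value of \<open>f\<close> have a least pattern \<open>(P, L)\<close>. If \<open>f\<close> is a
  state at \<open>x\<close> and \<open>y\<close>, then a common element of evaluation shows that it is a state at the
  restriction of \<open>x\<close> to the pattern of \<open>y\<close>. Patterns may therefore be intersected, and since only
  the finite set \<open>B\<close> matters for \<open>f\<close>, infinitely many may be. Minimality gives the other
  properties. The parts of \<open>P\<close> that are linked to the elements of \<open>B\<close> cover the element of
  evaluation, so one of them is all of \<open>P\<close>. Multiplying its base point by the finitely many
  letters that are needed to reach the elements of \<open>B\<close>, and by the letters in \<open>B\<close>, gives
  \<open>a\<close>; the pattern that \<open>a\<close> generates contains the relevant part of \<open>B\<close>, so it is
  \<open>(P, L)\<close> by minimality again.\<close>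

lemma principal_pattern:
  assumes no_letters: "\<And>x. x \<in> homs A M \<Longrightarrow> f x \<notin> letters M"
    and x0: "x0 \<in> homs A M" "f x0 \<in> states M"
  obtains P L a x where
    "pattern P L" "a \<in> P" "x \<in> homs A M" "f x \<in> states M" "state_part x = P" "letter_part x = L"
    "\<And>y. y \<in> homs A M \<Longrightarrow> f y \<in> states M \<longleftrightarrow> y a \<in> states M"
    "\<And>y s. y \<in> homs A M \<Longrightarrow> y a \<in> states M \<Longrightarrow> s \<in> L \<Longrightarrow> y s \<in> letters M"
    "\<And>p. p \<in> P \<Longrightarrow> \<exists>u w. set_mset u \<subseteq> L \<and> set_mset w \<subseteq> L \<and>
       (\<forall>y\<in>homs A M. y a \<in> states M \<longrightarrow> y p \<in> states M \<and>
          act (image_mset y u) (y p) = act (image_mset y w) (y a))"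
proof -
  define F where "F = {y \<in> homs A M. f y \<in> states M}"
  have F: "y \<in> homs A M" "f y \<in> states M" if "y \<in> F" for y using that by (auto simp: F_def)
  define P where "P = (\<Inter>y\<in>F. state_part y)"
  define L where "L = (\<Inter>y\<in>F. letter_part y)"
  have PL_le: "P \<subseteq> state_part y" "L \<subseteq> letter_part y" if "y \<in> F" for y
    using that by (auto simp: P_def L_def)
  have "x0 \<in> F" using x0 by (simp add: F_def)
  have pat: "pattern P L"
    unfolding P_def L_def using \<open>x0 \<in> F\<close> by (rule pattern_INT) (rule pattern_of_hom[OF F(1)])
  \<comment> \<open>A homomorphism \<open>x1\<close> that is minimal on \<open>B\<close> has the part of \<open>(P, L)\<close> in \<open>B\<close>, so \<open>f\<close> does not
    see that \<open>x1\<close> is cut down to \<open>(P, L)\<close>.\<close>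
  define weight where "weight y = card ((state_part y \<union> letter_part y) \<inter> B)" for y
  obtain x1 where x1: "x1 \<in> F" "\<And>y. y \<in> F \<Longrightarrow> weight x1 \<le> weight y"
    using ex_has_least_nat[of "\<lambda>y. y \<in> F" x0 weight] \<open>x0 \<in> F\<close> by blast
  have x1B: "state_part x1 \<inter> B \<subseteq> state_part y \<and> letter_part x1 \<inter> B \<subseteq> letter_part y"
    if y: "y \<in> F" for y
  proof -
    let ?P = "state_part x1 \<inter> state_part y" and ?L = "letter_part x1 \<inter> letter_part y"
    have p: "pattern ?P ?L"
      using pattern_INT[of x1 "{x1, y}" state_part letter_part] pattern_of_hom F x1(1) y by auto
    define z where "z = cut x1 ?P ?L"
    have z: "z \<in> homs A M" unfolding z_def by (rule cut_hom) (use F x1 p in auto)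
    obtain b where b: "b \<in> univ A" "f x1 = x1 b" "f y = y b" "f z = z b"
      by (rule locally'[of "{x1, y, z}"]) (use F x1 y z in auto)
    then have "b \<in> ?P" using F(2)[OF x1(1)] F(2)[OF y] by (simp add: state_part_def)
    then have "f z = x1 b" using b by (simp add: z_def cut_def)
    then have "z \<in> F" using F(2)[OF x1(1)] z b(2) by (simp add: F_def)
    have parts: "state_part z = ?P" "letter_part z = ?L"
      unfolding z_def by (rule cut_parts[OF p]; auto simp: state_part_def letter_part_def)+
    have "(?P \<union> ?L) \<inter> B = (state_part x1 \<union> letter_part x1) \<inter> B"
      using x1(2)[OF \<open>z \<in> F\<close>] finite_B unfolding weight_def parts
      by (intro card_seteq) auto
    then show ?thesis
      using states_letters_disjoint unfolding state_part_def letter_part_def by blast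
  qed
  define x where "x = cut x1 P L"
  have x_hom: "x \<in> homs A M"
    unfolding x_def by (rule cut_hom) (use F x1 pat PL_le in auto)
  have parts: "state_part x = P" "letter_part x = L"
    unfolding x_def
    by (rule cut_parts[OF pat]; use PL_le[OF x1(1)] in \<open>auto simp: state_part_def letter_part_def\<close>)+
  have "f x = f x1"
  proof (rule determined[OF x_hom])
    fix b assume b: "b \<in> B"
    have "b \<in> P \<union> L" if "b \<in> state_part x1 \<union> letter_part x1"
      using that b x1B unfolding P_def L_def by blast
    moreover have "x1 b = zero M" if "b \<notin> state_part x1 \<union> letter_part x1"
      using that b B_univ hom_univ[OF F(1)[OF x1(1)], of b] univ_eq
      by (auto simp: state_part_def letter_part_def)
    ultimately have "b \<in> P \<union> L \<or> x1 b = zero M" by blast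
    then show "x b = x1 b" using b B_univ by (auto simp: x_def cut_def)
  qed (use F x1 in auto)
  then have xF: "x \<in> F" using F(2)[OF x1(1)] x_hom by (simp add: F_def)
  have x_st: "x p \<in> states M" if "p \<in> P" for p using that parts by (auto simp: state_part_def)
  have x_lt: "x s \<in> letters M" if "s \<in> L" for s using that parts by (auto simp: letter_part_def)
  have pat_linked: "pattern (linked P L b) L" for b
    by (rule linked_pattern[OF pat]) auto
  have patL: "pattern {} L"
    using pattern_letters_only[OF x_hom, of L] parts by simp
  define cutb where "cutb b = cut x (linked P L b) L" for b
  have linked_P: "linked P L b \<subseteq> P" for b by (auto simp: linked_def)
  have cutb: "cutb b \<in> homs A M" for b
    unfolding cutb_def by (rule cut_hom[OF x_hom pat_linked]) (use parts linked_P in auto)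
  \<comment> \<open>Some element \<open>a\<close> of \<open>B\<close> is linked with all of \<open>P\<close>.\<close>
  obtain a where a: "a \<in> P" "P \<subseteq> linked P L a"
  proof -
    let ?U = "\<Union>b\<in>P \<inter> B. linked P L b"
    define z where "z = cut x ?U L"
    have z: "z \<in> homs A M"
      unfolding z_def
      by (rule cut_hom[OF x_hom pattern_UN[OF pat_linked patL]]) (use parts linked_P in auto)
    have "f z = f x"
    proof (rule determined[OF z x_hom])
      fix b assume b: "b \<in> B"
      show "z b = x b"
      proof (cases "b \<in> P \<union> L")
        case True
        then have "b \<in> ?U \<union> L" using b linked_refl[of b P L] by blast
        then show ?thesis using b B_univ by (auto simp: z_def cut_def)
      next
        case False
        then have "b \<notin> ?U \<union> L" using linked_P by blast
        then show ?thesis using False b B_univ by (auto simp: z_def x_def cut_def)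
      qed
    qed
    have "finite (insert z (cutb ` (P \<inter> B)))" using finite_B by auto
    then obtain c where c: "c \<in> univ A" "\<And>y. y \<in> insert z (cutb ` (P \<inter> B)) \<Longrightarrow> f y = y c"
      by (rule locally') (use z cutb in auto)
    have zc: "z c \<in> states M" using c(2)[of z] \<open>f z = f x\<close> F(2)[OF xF] by simp
    then have "c \<in> ?U"
      using c(1) x_lt[of c] zero_not_state states_letters_disjoint
      by (auto simp: z_def cut_def split: if_splits)
    then obtain b where b: "b \<in> P \<inter> B" "c \<in> linked P L b" by blast
    have "f (cutb b) = cutb b c" using c(2) b by blast
    also have "\<dots> = x c" using b c(1) by (simp add: cutb_def cut_def)
    finally have "cutb b \<in> F" using cutb x_st b linked_P by (auto simp: F_def)
    from PL_le(1)[OF this] have "P \<subseteq> linked P L b"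
      unfolding cutb_def
      by (subst (asm) cut_parts[OF pat_linked]) (use x_st x_lt linked_P in auto)
    then show thesis using that b by blast
  qed
  \<comment> \<open>The new base point \<open>a'\<close> is \<open>a\<close> times all letters \<open>ls\<close> that matter on \<open>B\<close>: if it is sent to a
    state, then these are sent to letters.\<close>
  define link where "link p u w \<longleftrightarrow> set_mset u \<subseteq> L \<and> set_mset w \<subseteq> L \<and>
     (\<forall>y\<in>homs A M. y ` set_mset u \<subseteq> letters M \<longrightarrow> y ` set_mset w \<subseteq> letters M \<longrightarrow> y a \<in> states M \<longrightarrow>
        y p \<in> states M \<and> act (image_mset y u) (y p) = act (image_mset y w) (y a))" for p u w
  have "\<exists>u w. link p u w" if "p \<in> P" for p
  proof -
    have "p \<in> linked P L a" using a(2) that by blast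
    then show ?thesis unfolding link_def by (rule linkedE) blast
  qed
  then obtain u w where link: "\<And>p. p \<in> P \<Longrightarrow> link p (u p) (w p)" by metis
  have uw: "set_mset (u p) \<subseteq> L" "set_mset (w p) \<subseteq> L" if "p \<in> P" for p
    using link[OF that] unfolding link_def by blast+
  have "finite ((B \<inter> L) \<union> (\<Union>b\<in>B \<inter> P. set_mset (u b + w b)))"
    by (intro finite_UnI finite_UN_I finite_set_mset) (simp_all add: finite_B)
  then obtain ls where ls: "set ls = (B \<inter> L) \<union> (\<Union>b\<in>B \<inter> P. set_mset (u b + w b))"
    by (metis finite_list)
  have ls_L: "set ls \<subseteq> L" using uw unfolding ls by auto
  then have ls_univ: "set ls \<subseteq> univ A" using pattern_univ[OF pat] by blast
  have a_univ: "a \<in> univ A" using a(1) pattern_univ[OF pat] by blast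
  define a' where "a' = word a ls"
  have a'_state: "y a' \<in> states M \<longleftrightarrow> y a \<in> states M \<and> y ` set ls \<subseteq> letters M" if "y \<in> homs A M" for y
    unfolding a'_def by (rule hom_word_state_iff[OF that a_univ ls_univ])
  have a'_act: "y a' = act (image_mset y (mset ls)) (y a)" if "y \<in> homs A M" "y a' \<in> states M" for y
    unfolding a'_def using that a'_state by (intro hom_word_act a_univ ls_univ) auto
  have "x a' \<in> states M"
    using a'_state[OF x_hom] x_st[OF a(1)] x_lt ls_L by auto
  then have a'_P: "a' \<in> P"
    using word_univ[OF a_univ ls_univ] unfolding parts(1)[symmetric] state_part_def a'_def by simp
  define L' where "L' = {s \<in> L. \<forall>y\<in>homs A M. y a' \<in> states M \<longrightarrow> y s \<in> letters M}"
  define P' where "P' = linked P L' a'"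
  have L': "L' \<subseteq> L" "\<And>y s. y \<in> homs A M \<Longrightarrow> y a' \<in> states M \<Longrightarrow> s \<in> L' \<Longrightarrow> y s \<in> letters M"
    by (auto simp: L'_def)
  have pat': "pattern P' L'"
    unfolding P'_def
  proof (rule linked_pattern[OF pat L'(1)])
    fix s assume "s \<in> L" "\<And>y. y \<in> homs A M \<Longrightarrow> y a' \<in> states M \<Longrightarrow> y ` L' \<subseteq> letters M \<Longrightarrow> y s \<in> letters M"
    then show "s \<in> L'" using L'(2) unfolding L'_def by blast
  qed
  have P'_le: "P' \<subseteq> P" by (auto simp: P'_def linked_def)
  define z where "z = cut x P' L'"
  have z: "z \<in> homs A M"
    unfolding z_def by (rule cut_hom[OF x_hom pat']) (use parts P'_le L'(1) in auto)
  have ls_L': "set ls \<subseteq> L'"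
    using ls_L a'_state unfolding L'_def by auto
  have BP: "b \<in> P'" if b: "b \<in> P" "b \<in> B" for b
    unfolding P'_def
  proof (rule linkedI[OF b(1), of "u b + mset ls" _ "w b"])
    have "set_mset (u b + w b) \<subseteq> set ls" using b unfolding ls by blast
    then show "set_mset (u b + mset ls) \<subseteq> L'" "set_mset (w b) \<subseteq> L'" using ls_L' by auto
    fix y assume y: "y \<in> homs A M" "y a' \<in> states M"
    have y': "y a \<in> states M" "y ` set ls \<subseteq> letters M" using y a'_state by auto
    have "y ` set_mset (u b) \<subseteq> letters M" "y ` set_mset (w b) \<subseteq> letters M"
      using \<open>set_mset (u b + w b) \<subseteq> set ls\<close> y'(2) by auto
    then have *: "y b \<in> states M" "act (image_mset y (u b)) (y b) = act (image_mset y (w b)) (y a)"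
      using link[OF b(1)] y(1) y'(1) unfolding link_def by blast+
    have "act (image_mset y (u b + mset ls)) (y b) = act (image_mset y (mset ls)) (act (image_mset y (w b)) (y a))"
      by (simp add: act_union act_commute flip: *(2))
    also have "\<dots> = act (image_mset y (w b)) (y a')"
      unfolding a'_act[OF y] by (rule act_commute)
    finally show "y b \<in> states M \<and>
        act (image_mset y (u b + mset ls)) (y b) = act (image_mset y (w b)) (y a')"
      using * by blast
  qed
  have "f z = f x"
  proof (rule determined[OF z x_hom])
    fix b assume b: "b \<in> B"
    have "b \<in> P \<union> L \<longleftrightarrow> b \<in> P' \<union> L'"
      using BP b ls_L' P'_le L'(1) unfolding ls by blast
    then show "z b = x b" using b B_univ by (auto simp: z_def x_def cut_def)
  qed
  then have zF: "z \<in> F" using F(2)[OF xF] z by (simp add: F_def)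
  \<comment> \<open>The pattern generated by \<open>a'\<close> is below the least one, hence equal to it.\<close>
  have eqs: "P' = P" "L' = L"
    using PL_le[OF zF] P'_le L'(1) x_st x_lt cut_parts[OF pat', of x] unfolding z_def by blast+
  have L_letters: "y s \<in> letters M" if "y \<in> homs A M" "y a' \<in> states M" "s \<in> L" for y s
    using L'(2) that eqs by blast
  have links: "\<exists>u w. set_mset u \<subseteq> L \<and> set_mset w \<subseteq> L \<and>
       (\<forall>y\<in>homs A M. y a' \<in> states M \<longrightarrow> y p \<in> states M \<and>
          act (image_mset y u) (y p) = act (image_mset y w) (y a'))" if "p \<in> P" for p
  proof -
    have "p \<in> linked P L a'" using that eqs P'_def by simp
    then obtain u w where *: "p \<in> P" "set_mset u \<subseteq> L" "set_mset w \<subseteq> L"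
      "\<forall>y\<in>homs A M. y ` set_mset u \<subseteq> letters M \<longrightarrow> y ` set_mset w \<subseteq> letters M \<longrightarrow> y a' \<in> states M \<longrightarrow>
        y p \<in> states M \<and> act (image_mset y u) (y p) = act (image_mset y w) (y a')"
      by (rule linkedE) (rule that)
    have "y p \<in> states M \<and> act (image_mset y u) (y p) = act (image_mset y w) (y a')"
      if "y \<in> homs A M" "y a' \<in> states M" for y
    proof -
      have "y ` set_mset u \<subseteq> letters M" "y ` set_mset w \<subseteq> letters M"
        using *(2,3) L_letters that by blast+
      then show ?thesis using *(4) that by blast
    qed
    with *(2,3) show ?thesis by (intro exI[of _ u] exI[of _ w]) simp
  qed
  have iff: "f y \<in> states M \<longleftrightarrow> y a' \<in> states M" if y: "y \<in> homs A M" for y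
  proof
    assume "f y \<in> states M"
    then have "P \<subseteq> state_part y" using PL_le(1) y by (auto simp: F_def)
    then show "y a' \<in> states M" using a'_P by (auto simp: state_part_def)
  next
    assume ya': "y a' \<in> states M"
    obtain b where b: "b \<in> univ A" "f x = x b" "f y = y b"
      by (rule locally'[of "{x, y}"]) (use x_hom y in auto)
    then have "b \<in> P" using F(2)[OF xF] parts(1) by (auto simp: state_part_def)
    then show "f y \<in> states M" using links ya' y b(3) by metis
  qed
  show thesis
  proof (rule that[of P L a' x])
    show "f y \<in> states M \<longleftrightarrow> y a' \<in> states M" if "y \<in> homs A M" for y
      by (rule iff[OF that])
    show "y s \<in> letters M" if "y \<in> homs A M" "y a' \<in> states M" "s \<in> L" for y s
      by (rule L_letters[OF that])
  qed (fact pat a'_P x_hom parts links | rule F(2)[OF xF])+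
qed

end

section \<open>The evaluation on a principal pattern\<close>

text \<open>The situation that \<open>principal_pattern\<close> provides. With \<open>L \<noteq> {}\<close> the
  element sought can be chosen as a product, which no homomorphism sends to a letter.\<close>

locale principal_evaluation = local_evaluation M A f B
  for M :: "'a automatic" and A :: "'b magma" and f B +
  fixes P L :: "'b set" and a :: 'b and x\<^sub>0 :: "'b \<Rightarrow> 'a"
  assumes no_letters: "\<And>y. y \<in> homs A M \<Longrightarrow> f y \<notin> letters M"
    and pat: "pattern P L" and a_P: "a \<in> P"
    and x0: "x\<^sub>0 \<in> homs A M" "f x\<^sub>0 \<in> states M" "state_part x\<^sub>0 = P" "letter_part x\<^sub>0 = L"
    and value_state_iff: "\<And>y. y \<in> homs A M \<Longrightarrow> f y \<in> states M \<longleftrightarrow> y a \<in> states M"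
    and L_letters: "\<And>y s. y \<in> homs A M \<Longrightarrow> y a \<in> states M \<Longrightarrow> s \<in> L \<Longrightarrow> y s \<in> letters M"
    and links: "\<And>p. p \<in> P \<Longrightarrow> \<exists>u w. set_mset u \<subseteq> L \<and> set_mset w \<subseteq> L \<and>
       (\<forall>y\<in>homs A M. y a \<in> states M \<longrightarrow> y p \<in> states M \<and>
          act (image_mset y u) (y p) = act (image_mset y w) (y a))"
    and L_nonempty: "L \<noteq> {}"
begin

lemma P_univ: "P \<subseteq> univ A" and L_univ: "L \<subseteq> univ A"
  using pattern_univ[OF pat] by auto

definition Y :: "('b \<Rightarrow> 'a) set" where
  "Y = {y \<in> homs A M. y a \<in> states M}"

text \<open>Elements outside \<open>L\<close> are given the trivially acting zero, so that words over \<open>L\<close> can be taken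
  from the whole type of multisets.\<close>

definition label :: "('b \<Rightarrow> 'a) \<Rightarrow> 'b \<Rightarrow> 'a" where
  "label y s = (if s \<in> L then y s else zero M)"

definition ev :: "('b \<Rightarrow> 'a) \<Rightarrow> 'b multiset \<Rightarrow> 'a" where
  "ev y m = act (image_mset (label y) m) (y a)"

lemma Y_hom: "y \<in> Y \<Longrightarrow> y \<in> homs A M" and Y_state: "y \<in> Y \<Longrightarrow> y a \<in> states M"
  by (auto simp: Y_def)

lemma Y_letter: "y \<in> Y \<Longrightarrow> s \<in> L \<Longrightarrow> y s \<in> letters M"
  by (auto simp: Y_def L_letters)

lemma step_zero [simp]: "step (zero M) q = q"
  by (simp add: step_def zero_not_letter)

lemma image_label:
  "set_mset m \<subseteq> L \<Longrightarrow> image_mset (label y) m = image_mset y m"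
  by (rule image_mset_cong) (auto simp: label_def)

lemma ev_eq: "set_mset m \<subseteq> L \<Longrightarrow> ev y m = act (image_mset y m) (y a)"
  by (simp add: ev_def image_label)

lemma ev_empty [simp]: "ev y {#} = y a"
  by (simp add: ev_def)

lemma ev_state: "y \<in> Y \<Longrightarrow> ev y m \<in> states M"
  by (simp add: ev_def Y_state)

lemma ev_union: "ev y (m + n) = act (image_mset (label y) m) (ev y n)"
  by (simp add: ev_def act_union)

lemma ev_add_left_cancel [simp]: "ev y (m + n) = ev y (m + n') \<longleftrightarrow> ev y n = ev y n'"
  by (simp add: ev_union)

lemma ev_add_right_cancel [simp]: "ev y (m + n) = ev y (m' + n) \<longleftrightarrow> ev y m = ev y m'"
  by (metis add.commute ev_add_left_cancel)

lemma image_repeat_mset: "image_mset g (repeat_mset k m) = repeat_mset k (image_mset g m)"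
  by (induction k) auto

lemma ev_period [simp]: "ev y (repeat_mset period m + n) = ev y n"
  by (simp add: ev_union image_repeat_mset)

lemma ev_filter: "ev y (filter_mset (\<lambda>s. s \<in> L) m) = ev y m"
  unfolding ev_def by (induction m) (auto simp: label_def)

text \<open>Inverses being multiples, a link between \<open>p\<close> and \<open>a\<close> is solved for \<open>p\<close>.\<close>

lemma P_value: "p \<in> P \<Longrightarrow> \<exists>v. set_mset v \<subseteq> L \<and> (\<forall>y\<in>Y. y p = ev y v)"
proof -
  assume "p \<in> P"
  then obtain u w where uw: "set_mset u \<subseteq> L" "set_mset w \<subseteq> L"
    "\<forall>y\<in>homs A M. y a \<in> states M \<longrightarrow> y p \<in> states M \<and>
          act (image_mset y u) (y p) = act (image_mset y w) (y a)"
    using links by blast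
  define v where "v = repeat_mset (period - 1) u + w"
  have "set_mset (repeat_mset k u) \<subseteq> L" for k
    using uw(1) by (induction k) auto
  then have v: "set_mset v \<subseteq> L"
    using uw(2) by (simp add: v_def)
  have "y p = ev y v" if y: "y \<in> Y" for y
  proof -
    have eq: "act (image_mset y u) (y p) = act (image_mset y w) (y a)"
      using uw(3) y by (simp add: Y_def)
    have "ev y v = act (repeat_mset (period - 1) (image_mset y u)) (act (image_mset y w) (y a))"
      unfolding ev_eq[OF v] by (simp add: v_def act_union image_repeat_mset)
    also have "\<dots> = y p" unfolding eq[symmetric] by (rule act_inverse)
    finally show ?thesis by simp
  qed
  with v show ?thesis by blast
qed

definition expr :: "'b \<Rightarrow> 'b multiset" where
  "expr p = (SOME v. set_mset v \<subseteq> L \<and> (\<forall>y\<in>Y. y p = ev y v))"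

lemma expr_L: "p \<in> P \<Longrightarrow> set_mset (expr p) \<subseteq> L"
  and expr_value: "p \<in> P \<Longrightarrow> y \<in> Y \<Longrightarrow> y p = ev y (expr p)"
  using someI_ex[OF P_value] unfolding expr_def by blast+

lemma local_word:
  assumes X: "finite X" "X \<subseteq> Y"
  obtains v where "set_mset v \<subseteq> L" "\<And>y. y \<in> X \<Longrightarrow> f y = ev y v"
proof -
  obtain b where b: "b \<in> univ A" "\<And>y. y \<in> insert x\<^sub>0 X \<Longrightarrow> f y = y b"
    by (rule locally'[of "insert x\<^sub>0 X"]) (use X x0 Y_hom in auto)
  then have "b \<in> P" unfolding x0(3)[symmetric] state_part_def using x0(2) by simp
  have "f y = ev y (expr b)" if "y \<in> X" for y
    using that b(2) X expr_value[OF \<open>b \<in> P\<close>] by auto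
  then show thesis using that expr_L[OF \<open>b \<in> P\<close>] by blast
qed

lemma determined_on_letters:
  "\<exists>\<Lambda>. finite \<Lambda> \<and> \<Lambda> \<subseteq> L \<and>
    (\<forall>y\<in>Y. \<forall>y'\<in>Y. y a = y' a \<longrightarrow> (\<forall>s\<in>\<Lambda>. y s = y' s) \<longrightarrow> f y = f y')"
proof -
  define \<Lambda> where "\<Lambda> = (B \<inter> L) \<union> (\<Union>b\<in>B \<inter> P. set_mset (expr b))"
  have fin: "finite \<Lambda>"
    unfolding \<Lambda>_def by (intro finite_UnI finite_UN_I finite_set_mset) (simp_all add: finite_B)
  have sub: "\<Lambda> \<subseteq> L" using expr_L unfolding \<Lambda>_def by auto
  have cut: "cut y P L \<in> homs A M \<and> f (cut y P L) = f y" if y: "y \<in> Y" for y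
  proof -
    have "y p \<in> states M" if "p \<in> P" for p
      using expr_value[OF that y] ev_state[OF y] by simp
    then have z: "cut y P L \<in> homs A M"
      using Y_hom[OF y] P_univ L_univ Y_letter[OF y] pat
      by (intro cut_hom) (auto simp: state_part_def letter_part_def)
    obtain b where b: "b \<in> univ A" "f x\<^sub>0 = x\<^sub>0 b" "f y = y b" "f (cut y P L) = cut y P L b"
      by (rule locally'[of "{x\<^sub>0, y, cut y P L}"]) (use x0 Y_hom[OF y] z in auto)
    then have "b \<in> P" unfolding x0(3)[symmetric] state_part_def using x0(2) by simp
    then show ?thesis using z b by (simp add: cut_def)
  qed
  show ?thesis
  proof (intro exI[of _ \<Lambda>] conjI ballI impI fin sub)
    fix y y' assume y: "y \<in> Y" "y' \<in> Y" "y a = y' a" "\<forall>s\<in>\<Lambda>. y s = y' s"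
    have "f (cut y P L) = f (cut y' P L)"
    proof (rule determined)
      fix b assume b: "b \<in> B"
      have "y b = y' b" if "b \<in> P"
      proof -
        have "set_mset (expr b) \<subseteq> \<Lambda>" using b that unfolding \<Lambda>_def by blast
        then have "image_mset y (expr b) = image_mset y' (expr b)"
          using y(4) by (intro image_mset_cong) blast
        then show ?thesis
          by (simp add: expr_value that y ev_eq expr_L)
      qed
      moreover have "y b = y' b" if "b \<in> L"
        using that b y(4) unfolding \<Lambda>_def by blast
      ultimately show "cut y P L b = cut y' P L b"
        using b B_univ by (auto simp: cut_def)
    qed (use cut[OF y(1)] cut[OF y(2)] in blast)+
    then show "f y = f y'" using cut[OF y(1)] cut[OF y(2)] by simp
  qed
qed

text \<open>Homomorphisms in \<open>Y\<close> can be prescribed by the state at \<open>a\<close> and the letters on \<open>L\<close>, provided that the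
  relations between words that hold throughout \<open>Y\<close> are respected: every element of \<open>P\<close> is \<open>a\<close>
  times a word, and the defining relation of a product is such a relation.\<close>

lemma hom_from_labels:
  assumes q: "q \<in> states M" and \<sigma>: "\<And>s. s \<in> L \<Longrightarrow> \<sigma> s \<in> letters M"
    and compat: "\<And>m m'. set_mset m \<subseteq> L \<Longrightarrow> set_mset m' \<subseteq> L \<Longrightarrow> (\<And>r. r \<in> Y \<Longrightarrow> ev r m = ev r m') \<Longrightarrow>
      act (image_mset \<sigma> m) q = act (image_mset \<sigma> m') q"
  obtains y where "y \<in> Y" "y a = q" "\<And>s. s \<in> L \<Longrightarrow> y s = \<sigma> s"
proof -
  have PL: "P \<inter> L = {}" using pat unfolding pattern_def by blast
  define y\<^sub>0 where "y\<^sub>0 p = (if p \<in> P then act (image_mset \<sigma> (expr p)) q else \<sigma> p)" for p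
  have y0_P: "y\<^sub>0 p = act (image_mset \<sigma> (expr p)) q" if "p \<in> P" for p
    using that by (simp add: y\<^sub>0_def)
  have y0_L: "y\<^sub>0 s = \<sigma> s" if "s \<in> L" for s
    using that PL by (auto simp: y\<^sub>0_def)
  define y where "y = cut y\<^sub>0 P L"
  have y: "y \<in> homs A M"
    unfolding y_def
  proof (rule cut_in_homs[OF pat])
    show "y\<^sub>0 p \<in> states M" if "p \<in> P" for p using that q by (simp add: y0_P)
    show "y\<^sub>0 s \<in> letters M" if "s \<in> L" for s using that \<sigma> by (simp add: y0_L)
    fix p s assume p: "p \<in> P" and s: "s \<in> L"
    have univ: "p \<in> univ A" "s \<in> univ A" using p s P_univ L_univ by auto
    have ps: "opn A p s \<in> P" using patternD(1)[OF pat univ] p s by blast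
    have "ev r (expr (opn A p s)) = ev r (add_mset s (expr p))" if r: "r \<in> Y" for r
    proof -
      have "r p \<in> states M" using expr_value[OF p r] ev_state[OF r] by simp
      then have "r (opn A p s) = step (r s) (r p)"
        using hom_opn_step[OF Y_hom[OF r] univ] Y_letter[OF r s] by blast
      then have "ev r (expr (opn A p s)) = step (r s) (ev r (expr p))"
        using expr_value[OF p r] expr_value[OF ps r] by simp
      then show ?thesis using s by (simp add: ev_def label_def)
    qed
    then have "y\<^sub>0 (opn A p s) = act (image_mset \<sigma> (add_mset s (expr p))) q"
      unfolding y0_P[OF ps] using expr_L[OF p] expr_L[OF ps] s by (intro compat) auto
    also have "\<dots> = step (\<sigma> s) (y\<^sub>0 p)" by (simp add: y0_P[OF p])
    also have "\<dots> = opn M (y\<^sub>0 p) (y\<^sub>0 s)" using q \<sigma>[OF s] by (simp add: step_def y0_P[OF p] y0_L[OF s])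
    finally show "y\<^sub>0 (opn A p s) = opn M (y\<^sub>0 p) (y\<^sub>0 s)" .
  qed
  have "y a = act (image_mset \<sigma> (expr a)) q"
    using a_P P_univ by (auto simp: y_def cut_def y0_P)
  also have "\<dots> = act (image_mset \<sigma> {#}) q"
    using expr_L[OF a_P] expr_value[OF a_P] by (intro compat) auto
  finally have "y a = q" by simp
  moreover have "y s = \<sigma> s" if "s \<in> L" for s
    using that L_univ by (auto simp: y_def cut_def y0_L)
  ultimately show thesis using that[of y] y q by (simp add: Y_def)
qed

text \<open>The values of \<open>f\<close> on \<open>Y\<close> depend only on \<open>y a\<close> and on the letters \<open>y s\<close> for \<open>s\<close> in a finite
  \<open>\<Lambda>\<close>. The finite set \<open>R\<close> represents all possibilities for these data, and \<open>h\<close> is the least positive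
  number such that the \<open>h\<close>-th powers of any two letters agree at \<open>r a\<close> for \<open>r \<in> R\<close>. Modulo
  equality on \<open>R\<close>, let \<open>N\<close> be generated by \<open>\<Lambda>\<close> and the \<open>h\<close>-fold multiples. A word \<open>w\<^sub>0\<close> that
  evaluates correctly on \<open>R\<close> lies in \<open>N\<close>, for otherwise a character that vanishes on \<open>N\<close> but not
  at \<open>w\<^sub>0\<close> would twist the elements of \<open>R\<close> into finitely many homomorphisms that \<open>f\<close> cannot
  distinguish from \<open>R\<close> and for which, together with \<open>R\<close>, no word evaluates correctly. As an
  element of \<open>N\<close>, the word \<open>w\<^sub>0\<close> may be chosen as \<open>l + h z\<close>, and then it evaluates correctly on all
  of \<open>Y\<close>: on \<open>l\<close> a homomorphism agrees with its representative, and on \<open>h z\<close> the letters do not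
  matter.\<close>

lemma evaluation_principal: "evaluation A M f"
proof -
  obtain \<Lambda> where \<Lambda>: "finite \<Lambda>" "\<Lambda> \<subseteq> L"
    and all: "\<forall>y\<in>Y. \<forall>y'\<in>Y. y a = y' a \<longrightarrow> (\<forall>s\<in>\<Lambda>. y s = y' s) \<longrightarrow> f y = f y'"
    using determined_on_letters by (elim exE conjE) (rule that; assumption)
  have \<Lambda>_det: "f y = f y'" if "y \<in> Y" "y' \<in> Y" "y a = y' a" "\<And>s. s \<in> \<Lambda> \<Longrightarrow> y s = y' s" for y y'
    using bspec[OF bspec[OF all that(1)] that(2)] that(3,4) by simp
  define restr where "restr y = (y a, restrict y \<Lambda>)" for y :: "'b \<Rightarrow> 'a"
  have "restr ` Y \<subseteq> states M \<times> (\<Lambda> \<rightarrow>\<^sub>E letters M)"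
    using Y_state Y_letter \<Lambda>(2) unfolding restr_def by auto
  then have "finite (restr ` Y)"
    by (rule finite_subset) (intro finite_cartesian_product finite_PiE finite_states finite_letters \<Lambda>)
  then obtain R where R: "R \<subseteq> Y" "finite R" and "restr ` Y = restr ` R"
    using finite_subset_image[of "restr ` Y" restr Y] by auto
  have rep: "\<exists>r\<in>R. y a = r a \<and> (\<forall>s\<in>\<Lambda>. y s = r s)" if "y \<in> Y" for y
  proof -
    have "restr y \<in> restr ` R" using \<open>restr ` Y = restr ` R\<close> that by blast
    then obtain r where "r \<in> R" "restr y = restr r" by blast
    then show ?thesis unfolding restr_def by (metis prod.inject restrict_apply')
  qed
  define equalizes where "equalizes n \<longleftrightarrow> (\<forall>r\<in>R. \<forall>\<alpha>\<in>letters M. \<forall>\<beta>\<in>letters M.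
      act (replicate_mset n \<alpha>) (r a) = act (replicate_mset n \<beta>) (r a))" for n
  define h where "h = (LEAST n. n > 0 \<and> equalizes n)"
  have "equalizes period"
    unfolding equalizes_def using act_period[of "{#_#}"] by simp
  then have h: "h > 0" "equalizes h"
    unfolding h_def using LeastI[of "\<lambda>n. n > 0 \<and> equalizes n" period] period_pos by auto
  have equalizes_h: "act (replicate_mset (j * h) \<alpha>) (r a) = act (replicate_mset (j * h) \<beta>) (r a)"
    if "r \<in> R" "\<alpha> \<in> letters M" "\<beta> \<in> letters M" for r \<alpha> \<beta> j
  proof (induction j)
    case (Suc j)
    have "act (replicate_mset (Suc j * h) \<alpha>) (r a)
        = act (replicate_mset h \<alpha>) (act (replicate_mset (j * h) \<alpha>) (r a))"
      by (simp add: act_replicate_add act_union)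
    also have "\<dots> = act (replicate_mset h \<alpha>) (act (replicate_mset (j * h) \<beta>) (r a))"
      by (simp add: Suc)
    also have "\<dots> = act (replicate_mset (j * h) \<beta>) (act (replicate_mset h \<alpha>) (r a))"
      by (rule act_commute)
    also have "act (replicate_mset h \<alpha>) (r a) = act (replicate_mset h \<beta>) (r a)"
      using h(2) that unfolding equalizes_def by blast
    also have "act (replicate_mset (j * h) \<beta>) (act (replicate_mset h \<beta>) (r a))
        = act (replicate_mset (Suc j * h) \<beta>) (r a)"
      by (subst act_commute) (simp add: act_replicate_add act_union)
    finally show ?case .
  qed simp
  have h_dvd: "h dvd n" if n: "equalizes n" for n
  proof -
    have split: "act (replicate_mset n \<alpha>) q
        = act (replicate_mset (n mod h) \<alpha>) (act (replicate_mset (n div h * h) \<alpha>) q)" for \<alpha> q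
      by (simp flip: act_replicate_add)
    have "equalizes (n mod h)"
      unfolding equalizes_def
    proof (intro ballI)
      fix r \<alpha> \<beta> assume *: "r \<in> R" "\<alpha> \<in> letters M" "\<beta> \<in> letters M"
      have "act (replicate_mset (n div h * h) \<alpha>) (act (replicate_mset (n mod h) \<alpha>) (r a))
          = act (replicate_mset n \<alpha>) (r a)"
        unfolding split[of \<alpha>] by (rule act_commute)
      also have "\<dots> = act (replicate_mset n \<beta>) (r a)"
        using n * unfolding equalizes_def by blast
      also have "\<dots> = act (replicate_mset (n mod h) \<beta>) (act (replicate_mset (n div h * h) \<alpha>) (r a))"
        unfolding split[of \<beta>] equalizes_h[OF *] ..
      also have "\<dots> = act (replicate_mset (n div h * h) \<alpha>) (act (replicate_mset (n mod h) \<beta>) (r a))"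
        by (rule act_commute)
      finally show "act (replicate_mset (n mod h) \<alpha>) (r a) = act (replicate_mset (n mod h) \<beta>) (r a)"
        by simp
    qed
    then have "n mod h = 0"
      using not_less_Least[of "n mod h" "\<lambda>n. n > 0 \<and> equalizes n"] h(1)
      unfolding h_def[symmetric] by auto
    then show ?thesis by auto
  qed
  \<comment> \<open>Equality of words on \<open>R\<close> is a congruence, and \<open>N\<close> is a union of its classes.\<close>
  define eqv where "eqv m m' \<longleftrightarrow> (\<forall>r\<in>R. ev r m = ev r m')" for m m'
  have eqv_add: "eqv (m + n) (m' + n')" if "eqv m m'" "eqv n n'" for m m' n n'
    unfolding eqv_def
  proof
    fix r assume "r \<in> R"
    then have "ev r (m + n) = ev r (m + n')" "ev r (m + n') = ev r (m' + n')"
      using that by (auto simp: eqv_def)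
    then show "ev r (m + n) = ev r (m' + n')" by simp
  qed
  have eqv_repeat: "eqv (repeat_mset k m) (repeat_mset k m')" if "eqv m m'" for k m m'
    by (induction k) (use that eqv_add in \<open>auto simp: eqv_def\<close>)
  have eqv_period: "eqv (repeat_mset period m + n) n" for m n by (simp add: eqv_def)
  have eqv_sym: "eqv m m' \<Longrightarrow> eqv m' m" for m m' by (simp add: eqv_def)
  have eqv_trans: "eqv m m' \<Longrightarrow> eqv m' m'' \<Longrightarrow> eqv m m''" for m m' m'' by (simp add: eqv_def)
  have eqv_refl: "eqv m m" for m by (simp add: eqv_def)
  have period_split: "repeat_mset (period - 1) m + m = repeat_mset period m" for m :: "'b multiset"
    using period_pos by (metis Suc_diff_1 add.commute repeat_mset_Suc)
  define N where "N = {m. \<exists>l z. set_mset l \<subseteq> \<Lambda> \<and> eqv m (l + repeat_mset h z)}"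
  have N_I: "m \<in> N" if "set_mset l \<subseteq> \<Lambda>" "eqv m (l + repeat_mset h z)" for m l z
    using that unfolding N_def by blast
  have set_repeat: "set_mset (repeat_mset k m) \<subseteq> set_mset m" for k and m :: "'b multiset"
    by (induction k) auto
  have N_closed: "m \<in> N" if m: "eqv (repeat_mset j x + m) y" "x \<in> N" "y \<in> N" for m x y j
  proof -
    obtain l z l' z' where lz: "set_mset l \<subseteq> \<Lambda>" "eqv x (l + repeat_mset h z)"
       "set_mset l' \<subseteq> \<Lambda>" "eqv y (l' + repeat_mset h z')"
      using m(2,3) unfolding N_def by blast
    let ?k = "(period - 1) * j"
    have split: "repeat_mset period (repeat_mset j x) = repeat_mset ?k x + repeat_mset j x"
      using period_split[of "repeat_mset j x"] by (simp only: repeat_mset_right)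
    have "eqv m (repeat_mset period (repeat_mset j x) + m)"
      by (rule eqv_sym[OF eqv_period])
    also have "repeat_mset period (repeat_mset j x) + m = repeat_mset ?k x + (repeat_mset j x + m)"
      by (simp only: split add.assoc)
    finally have e1: "eqv m (repeat_mset ?k x + (repeat_mset j x + m))" .
    have e2: "eqv (repeat_mset ?k x + (repeat_mset j x + m))
        (repeat_mset ?k (l + repeat_mset h z) + (l' + repeat_mset h z'))"
      by (intro eqv_add eqv_repeat lz eqv_trans[OF m(1)])
    have e3: "repeat_mset ?k (l + repeat_mset h z) + (l' + repeat_mset h z')
        = (repeat_mset ?k l + l') + repeat_mset h (repeat_mset ?k z + z')"
      by (simp add: ac_simps)
    have "eqv m ((repeat_mset ?k l + l') + repeat_mset h (repeat_mset ?k z + z'))"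
      using eqv_trans[OF e1 e2] unfolding e3 .
    moreover have "set_mset (repeat_mset ?k l + l') \<subseteq> \<Lambda>" using lz set_repeat[of ?k l] by auto
    ultimately show ?thesis by (intro N_I)
  qed
  have N_empty: "{#} \<in> N" by (rule N_I[of "{#}" _ "{#}"]) (auto simp: eqv_refl)
  have N_eqv: "m \<in> N" if "eqv m m'" "m' \<in> N" for m m'
    using N_closed[of 0 "{#}" m m'] that N_empty by simp
  have N_sat: "saturated N"
    unfolding saturated_def
  proof (intro conjI ballI allI impI N_empty)
    fix x y assume "x \<in> N" "x + y \<in> N"
    then show "y \<in> N" using N_closed[of 1 x y "x + y"] eqv_refl by simp
  next
    fix x y assume xy: "x \<in> N" "y \<in> N"
    have "eqv (repeat_mset (period - 1) x + (x + y)) y"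
      using eqv_period[of x y] period_split[of x] by (simp add: add.assoc[symmetric])
    then show "x + y \<in> N" using N_closed xy by blast
  qed
  have N_h: "repeat_mset h z \<in> N" for z
    by (rule N_I[of "{#}" _ z]) (auto simp: eqv_refl)
  have N_letter: "{#s#} \<in> N" if "s \<in> \<Lambda>" for s
    by (rule N_I[of "{#s#}" _ "{#}"]) (use that in \<open>auto simp: eqv_refl\<close>)
  have N_period: "m' + repeat_mset (period - 1) m \<in> N" if "eqv m' m" for m m'
  proof -
    have "eqv (m' + repeat_mset (period - 1) m) (m + repeat_mset (period - 1) m)"
      by (rule eqv_add[OF that eqv_refl])
    also have "m + repeat_mset (period - 1) m = repeat_mset period m + {#}"
      using period_split[of m] by (simp add: add.commute)
    finally show ?thesis using N_eqv N_empty eqv_trans[OF _ eqv_period] by metis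
  qed
  obtain w\<^sub>0 where "set_mset w\<^sub>0 \<subseteq> L" and w0: "\<And>r. r \<in> R \<Longrightarrow> f r = ev r w\<^sub>0"
    using local_word[OF R(2,1)] by metis
  have "w\<^sub>0 \<in> N"
  proof (rule ccontr)
    assume "w\<^sub>0 \<notin> N"
    have fin_\<kappa>: "finite (range (\<lambda>m. \<lambda>r\<in>R. ev r m))"
    proof (rule finite_subset)
      show "range (\<lambda>m. \<lambda>r\<in>R. ev r m) \<subseteq> R \<rightarrow>\<^sub>E states M"
        using ev_state R(1) by auto
      show "finite (R \<rightarrow>\<^sub>E states M)" by (intro finite_PiE R finite_states)
    qed
    have \<kappa>: "\<exists>z. m' + z \<in> N \<and> m + z \<in> N" if "(\<lambda>r\<in>R. ev r m') = (\<lambda>r\<in>R. ev r m)" for m m'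
    proof -
      have "eqv m' m" unfolding eqv_def using that by (metis restrict_apply')
      then show ?thesis using N_period eqv_refl by blast
    qed
    obtain \<chi> where \<chi>: "additive_mod h UNIV \<chi>" "\<And>m. m \<in> N \<Longrightarrow> [\<chi> m = 0] (mod h)"
      "\<not> [\<chi> w\<^sub>0 = 0] (mod h)"
      by (rule separating_character[OF N_sat h(1) N_h fin_\<kappa> \<kappa> \<open>w\<^sub>0 \<notin> N\<close>]) auto
    have \<chi>_add: "[\<chi> (m + n) = \<chi> m + \<chi> n] (mod h)" for m n
      using \<chi>(1) unfolding additive_mod_def by blast
    define c where "c m = nat (\<chi> m mod h)" for m
    have c_int: "int (c m) = \<chi> m mod h" for m
      using h(1) by (simp add: c_def)
    have c_less: "c m < h" for m
      using h(1) by (simp add: c_def nat_less_iff)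
    have c_N: "c m = 0" if "m \<in> N" for m
      using \<chi>(2)[OF that] by (simp add: c_def cong_def)
    have c_eqv: "c m = c m'" if "eqv m m'" for m m'
    proof -
      let ?z = "repeat_mset (period - 1) m'"
      have "[\<chi> m + \<chi> ?z = 0] (mod h)" "[\<chi> m' + \<chi> ?z = 0] (mod h)"
        using \<chi>(2)[OF N_period[OF that]] \<chi>(2)[OF N_period[OF eqv_refl]] \<chi>_add
        by (meson cong_sym cong_trans)+
      then have "[\<chi> m + \<chi> ?z = \<chi> m' + \<chi> ?z] (mod h)" by (meson cong_sym cong_trans)
      then have "[\<chi> m = \<chi> m'] (mod h)" by (simp add: cong_add_rcancel)
      then show ?thesis by (simp add: c_def cong_def)
    qed
    have c_add: "(c m + c n) mod h = c (m + n)" for m n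
    proof -
      have "int ((c m + c n) mod h) = (\<chi> m + \<chi> n) mod h"
        by (simp add: c_int zmod_int mod_add_eq)
      also have "\<dots> = int (c (m + n))" using \<chi>_add[of m n] by (simp add: c_int cong_def)
      finally show ?thesis by simp
    qed
    \<comment> \<open>The twist of \<open>r\<close> multiplies the action of a word \<open>m\<close> at \<open>r a\<close> by \<open>(\<alpha> / \<beta>)^(c m)\<close>; in
      the equation the power of \<open>\<beta>\<close> stands on the other side.\<close>
    have twist: "\<exists>y\<in>Y. y a = r a \<and> (\<forall>s\<in>\<Lambda>. y s = r s) \<and> (\<forall>m. set_mset m \<subseteq> L \<longrightarrow>
        act (image_mset y m) (act (replicate_mset (c m) \<beta>) (r a))
        = act (image_mset r m) (act (replicate_mset (c m) \<alpha>) (r a)))"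
      if *: "r \<in> R" "\<alpha> \<in> letters M" "\<beta> \<in> letters M" for r \<alpha> \<beta>
    proof -
      let ?q = "r a"
      have r: "r \<in> Y" using * R by blast
      have "\<exists>d\<in>letters M. step d (act (replicate_mset (c {#s#}) \<beta>) ?q)
          = step (r s) (act (replicate_mset (c {#s#}) \<alpha>) ?q) \<and> (c {#s#} = 0 \<longrightarrow> d = r s)"
        if "s \<in> L" for s
      proof (cases "c {#s#} = 0")
        case True
        then show ?thesis using Y_letter[OF r that] by auto
      next
        case False
        then show ?thesis
          using affine_power[OF Y_state[OF r] *(2,3) Y_letter[OF r that], of "c {#s#}"] by auto
      qed
      then obtain \<sigma> where \<sigma>: "\<And>s. s \<in> L \<Longrightarrow> \<sigma> s \<in> letters M"
        "\<And>s. s \<in> L \<Longrightarrow> step (\<sigma> s) (act (replicate_mset (c {#s#}) \<beta>) ?q)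
          = step (r s) (act (replicate_mset (c {#s#}) \<alpha>) ?q)"
        "\<And>s. s \<in> L \<Longrightarrow> c {#s#} = 0 \<Longrightarrow> \<sigma> s = r s"
        by metis
      define tw where "tw k m \<longleftrightarrow> act (image_mset \<sigma> m) (act (replicate_mset k \<beta>) ?q)
          = act (image_mset r m) (act (replicate_mset k \<alpha>) ?q)" for k m
      \<comment> \<open>Exponents matter only modulo \<open>h\<close>, as the \<open>h\<close>-th powers of \<open>\<alpha>\<close> and \<open>\<beta>\<close> agree at \<open>r a\<close>.\<close>
      have tw_mod: "tw (k mod h) m" if "tw k m" for k m
      proof -
        let ?i = "k mod h" and ?j = "k div h * h"
        have split: "act (replicate_mset k \<gamma>) q = act (replicate_mset ?i \<gamma>) (act (replicate_mset ?j \<gamma>) q)"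
          for \<gamma> q by (simp flip: act_replicate_add)
        have "act (replicate_mset ?j \<alpha>) (act (image_mset \<sigma> m) (act (replicate_mset ?i \<beta>) ?q))
            = act (image_mset \<sigma> m) (act (replicate_mset k \<beta>) ?q)"
          unfolding split[of \<beta>] equalizes_h[OF *, symmetric]
          by (metis act_commute)
        also have "\<dots> = act (image_mset r m) (act (replicate_mset k \<alpha>) ?q)"
          using that by (simp add: tw_def)
        also have "\<dots> = act (replicate_mset ?j \<alpha>) (act (image_mset r m) (act (replicate_mset ?i \<alpha>) ?q))"
          unfolding split[of \<alpha>] by (metis act_commute)
        finally show ?thesis by (simp add: tw_def)
      qed
      have tw: "tw (c m) m" if "set_mset m \<subseteq> L" for m
        using that
      proof (induction m)
        case empty
        then show ?case using c_N[OF N_empty] by (simp add: tw_def)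
      next
        case (add s m)
        have IH: "tw (c m) m" and s: "s \<in> L" using add by auto
        let ?\<alpha> = "\<lambda>k. replicate_mset k \<alpha>" and ?\<beta> = "\<lambda>k. replicate_mset k \<beta>"
        let ?i = "c {#s#}" and ?j = "c m"
        have "act (image_mset \<sigma> (add_mset s m)) (act (?\<beta> (?i + ?j)) ?q)
            = act (image_mset \<sigma> m) (act (?\<beta> ?j) (step (\<sigma> s) (act (?\<beta> ?i) ?q)))"
          using act_commute[of "{#\<sigma> s#}"] act_commute[of "?\<beta> ?i" "?\<beta> ?j"]
          by (simp add: act_replicate_add act_union)
        also have "\<dots> = act (image_mset \<sigma> m) (act (?\<beta> ?j) (step (r s) (act (?\<alpha> ?i) ?q)))"
          by (simp only: \<sigma>(2)[OF s])
        also have "\<dots> = step (r s) (act (?\<alpha> ?i) (act (image_mset \<sigma> m) (act (?\<beta> ?j) ?q)))"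
          using act_commute[of "{#r s#}"] by (simp add: act_commute[of _ "?\<alpha> ?i"])
        also have "\<dots> = step (r s) (act (?\<alpha> ?i) (act (image_mset r m) (act (?\<alpha> ?j) ?q)))"
          using IH by (simp add: tw_def)
        also have "\<dots> = act (image_mset r (add_mset s m)) (act (?\<alpha> (?i + ?j)) ?q)"
          by (simp only: image_mset_add_mset act_add_mset act_replicate_add
              act_commute[of "?\<alpha> ?i" "image_mset r m"])
        finally have "tw (?i + ?j) (add_mset s m)" by (simp add: tw_def)
        from tw_mod[OF this] show ?case using c_add[of "{#s#}" m] by simp
      qed
      obtain y where y: "y \<in> Y" "y a = ?q" "\<And>s. s \<in> L \<Longrightarrow> y s = \<sigma> s"
      proof (rule hom_from_labels[OF Y_state[OF r], of \<sigma>])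
        fix m m' assume m: "set_mset m \<subseteq> L" "set_mset m' \<subseteq> L" "\<And>r. r \<in> Y \<Longrightarrow> ev r m = ev r m'"
        have c_eq: "c m = c m'" using m(3) R(1) by (intro c_eqv) (auto simp: eqv_def)
        have ev_eq: "act (image_mset r m) ?q = act (image_mset r m') ?q"
          using m(3)[OF r] m(1,2) by (simp add: ev_eq)
        have "act (replicate_mset (c m) \<beta>) (act (image_mset \<sigma> m) ?q)
            = act (image_mset \<sigma> m) (act (replicate_mset (c m) \<beta>) ?q)" by (rule act_commute)
        also have "\<dots> = act (replicate_mset (c m) \<alpha>) (act (image_mset r m) ?q)"
          using tw[OF m(1)] unfolding tw_def by (simp add: act_commute)
        also have "\<dots> = act (image_mset r m') (act (replicate_mset (c m) \<alpha>) ?q)"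
          unfolding ev_eq by (rule act_commute)
        also have "\<dots> = act (image_mset \<sigma> m') (act (replicate_mset (c m) \<beta>) ?q)"
          using tw[OF m(2)] unfolding tw_def c_eq by simp
        also have "\<dots> = act (replicate_mset (c m) \<beta>) (act (image_mset \<sigma> m') ?q)"
          by (rule act_commute)
        finally show "act (image_mset \<sigma> m) ?q = act (image_mset \<sigma> m') ?q" by simp
      qed (use \<sigma>(1) in auto)
      have "image_mset y m = image_mset \<sigma> m" if "set_mset m \<subseteq> L" for m
        using that y(3) by (intro image_mset_cong) blast
      moreover have "y s = r s" if "s \<in> \<Lambda>" for s
        using y(3) \<sigma>(3) c_N[OF N_letter[OF that]] that \<Lambda>(2) by auto
      ultimately show ?thesis using y(1,2) tw unfolding tw_def by (metis (no_types, lifting))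
    qed
    define twisted where "twisted y r \<alpha> \<beta> \<longleftrightarrow> y \<in> Y \<and> y a = r a \<and> (\<forall>s\<in>\<Lambda>. y s = r s) \<and>
        (\<forall>m. set_mset m \<subseteq> L \<longrightarrow> act (image_mset y m) (act (replicate_mset (c m) \<beta>) (r a))
          = act (image_mset r m) (act (replicate_mset (c m) \<alpha>) (r a)))" for y r \<alpha> \<beta>
    define T where "T = R \<times> letters M \<times> letters M"
    have "\<exists>y. twisted y r \<alpha> \<beta>" if "r \<in> R" "\<alpha> \<in> letters M" "\<beta> \<in> letters M" for r \<alpha> \<beta>
      using twist[OF that] unfolding twisted_def by blast
    then obtain \<tau> where \<tau>: "\<And>r \<alpha> \<beta>. r \<in> R \<Longrightarrow> \<alpha> \<in> letters M \<Longrightarrow> \<beta> \<in> letters M \<Longrightarrow> twisted (\<tau> r \<alpha> \<beta>) r \<alpha> \<beta>"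
      by metis
    define t where "t = (\<lambda>(r, \<alpha>, \<beta>). \<tau> r \<alpha> \<beta>)"
    have t: "twisted (t (r, \<alpha>, \<beta>)) r \<alpha> \<beta>" if "(r, \<alpha>, \<beta>) \<in> T" for r \<alpha> \<beta>
      using that \<tau> by (simp add: T_def t_def)
    have "finite T" unfolding T_def using R(2) finite_letters by blast
    have "finite (R \<union> t ` T)" using \<open>finite T\<close> R(2) by blast
    moreover have "R \<union> t ` T \<subseteq> Y" using R(1) t unfolding twisted_def by auto
    ultimately obtain w where w: "set_mset w \<subseteq> L" "\<And>y. y \<in> R \<union> t ` T \<Longrightarrow> f y = ev y w"
      using local_word by metis
    \<comment> \<open>As \<open>f\<close> is the same at \<open>r\<close> and at its twists, \<open>(\<alpha> / \<beta>)^(c w)\<close> fixes \<open>r a\<close> for all \<open>\<alpha>\<close>,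
      \<open>\<beta>\<close>, which forces \<open>h\<close> to divide \<open>c w = c w\<^sub>0\<close>.\<close>
    have "equalizes (c w)"
      unfolding equalizes_def
    proof (intro ballI)
      fix r \<alpha> \<beta> assume *: "r \<in> R" "\<alpha> \<in> letters M" "\<beta> \<in> letters M"
      then have T: "(r, \<alpha>, \<beta>) \<in> T" by (simp add: T_def)
      let ?y = "t (r, \<alpha>, \<beta>)"
      have y: "?y \<in> Y" "?y a = r a" "\<And>s. s \<in> \<Lambda> \<Longrightarrow> ?y s = r s"
        using t[OF T] unfolding twisted_def by blast+
      have "r \<in> Y" using * R(1) by blast
      have "f ?y = f r" by (rule \<Lambda>_det[OF y(1) \<open>r \<in> Y\<close> y(2,3)])
      then have "ev ?y w = ev r w" using w(2)[of ?y] w(2)[of r] T * by auto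
      then have eq: "act (image_mset ?y w) (r a) = act (image_mset r w) (r a)"
        using y(2) by (simp add: ev_eq[OF w(1)])
      have "act (image_mset r w) (act (replicate_mset (c w) \<beta>) (r a))
          = act (replicate_mset (c w) \<beta>) (act (image_mset ?y w) (r a))"
        unfolding eq by (rule act_commute)
      also have "\<dots> = act (image_mset ?y w) (act (replicate_mset (c w) \<beta>) (r a))"
        by (rule act_commute)
      also have "\<dots> = act (image_mset r w) (act (replicate_mset (c w) \<alpha>) (r a))"
        using t[OF T] w(1) unfolding twisted_def by blast
      finally show "act (replicate_mset (c w) \<alpha>) (r a) = act (replicate_mset (c w) \<beta>) (r a)"
        by simp
    qed
    then have "c w = 0" using h_dvd[of "c w"] c_less[of w] by (metis dvd_imp_le gr0I not_le)
    moreover have "eqv w w\<^sub>0" unfolding eqv_def using w(2) w0 by auto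
    ultimately have "c w\<^sub>0 = 0" using c_eqv by metis
    then have "\<chi> w\<^sub>0 mod h = 0" using c_int[of w\<^sub>0] by simp
    then show False using \<chi>(3) by (simp add: cong_def)
  qed
  then obtain l z where lz: "set_mset l \<subseteq> \<Lambda>" "eqv w\<^sub>0 (l + repeat_mset h z)"
    unfolding N_def by blast
  have f_eq: "f y = ev y (repeat_mset h z + l)" if y: "y \<in> Y" for y
  proof -
    obtain r where r: "r \<in> R" "y a = r a" "\<And>s. s \<in> \<Lambda> \<Longrightarrow> y s = r s" using rep[OF y] by blast
    have rY: "r \<in> Y" using r R by blast
    have "act (image_mset (label y) (repeat_mset h z)) (r a) = act (image_mset (label r) (repeat_mset h z)) (r a)"
    proof (induction z)
      case (add s z)
      have s: "act (replicate_mset h (label y s)) (r a) = act (replicate_mset h (label r s)) (r a)"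
        using h(2) r(1) Y_letter[OF y] Y_letter[OF rY] unfolding equalizes_def label_def by auto
      have "act (image_mset (label y) (repeat_mset h (add_mset s z))) (r a)
          = act (replicate_mset h (label y s)) (act (image_mset (label y) (repeat_mset h z)) (r a))"
        by (simp add: act_union)
      also have "\<dots> = act (image_mset (label r) (repeat_mset h z)) (act (replicate_mset h (label r s)) (r a))"
        unfolding add by (subst act_commute) (simp only: s)
      also have "\<dots> = act (image_mset (label r) (repeat_mset h (add_mset s z))) (r a)"
        by (subst act_commute) (simp add: act_union)
      finally show ?case .
    qed simp
    moreover have "image_mset (label y) l = image_mset (label r) l"
      using lz(1) r(3) by (intro image_mset_cong) (auto simp: label_def)
    ultimately have "ev y (repeat_mset h z + l) = ev r (repeat_mset h z + l)"
      unfolding ev_def image_mset_union by (metis act_union act_commute r(2))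
    also have "\<dots> = ev r w\<^sub>0" using lz(2) r(1) by (simp add: eqv_def add.commute)
    also have "\<dots> = f r" using w0 r(1) by simp
    also have "\<dots> = f y" by (rule \<Lambda>_det) (use r rY y in auto)
    finally show ?thesis by simp
  qed
  \<comment> \<open>The trivially acting power of \<open>s\<^sub>0\<close> makes the word nonempty, so that homomorphisms outside \<open>Y\<close>
    send \<open>a\<close> times the word to zero even if they send \<open>a\<close> to a letter.\<close>
  obtain s\<^sub>0 where s0: "s\<^sub>0 \<in> L" using L_nonempty by blast
  define w where "w = repeat_mset period {#s\<^sub>0#} + (repeat_mset h z + l)"
  obtain ls where ls: "mset ls = filter_mset (\<lambda>s. s \<in> L) w" using ex_mset by blast
  have "set ls = set_mset (filter_mset (\<lambda>s. s \<in> L) w)" using ls by (metis set_mset_mset)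
  then have ls_L: "set ls \<subseteq> L" and "s\<^sub>0 \<in> set ls" using s0 period_pos by (auto simp: w_def)
  then have ls_univ: "set ls \<subseteq> univ A" "ls \<noteq> []" using L_univ by auto
  have a_univ: "a \<in> univ A" using a_P P_univ by blast
  have "f y = y (word a ls)" if y: "y \<in> homs A M" for y
  proof (cases "y \<in> Y")
    case True
    have "y (word a ls) = act (image_mset y (mset ls)) (y a)"
      by (rule hom_word_act[OF y a_univ ls_univ(1)])
         (use True Y_state Y_letter ls_L in auto)
    also have "\<dots> = ev y (mset ls)" using ls_L by (simp add: ev_eq)
    also have "\<dots> = ev y (repeat_mset h z + l)" unfolding ls ev_filter w_def by (rule ev_period)
    finally show ?thesis using f_eq[OF True] by simp
  next
    case False
    then have ya: "y a \<notin> states M" using y by (simp add: Y_def)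
    obtain b where "b \<in> univ A" "f y = y b" by (rule locally'[of "{y}"]) (use y in auto)
    then have "f y \<in> univ M" using hom_univ[OF y] by simp
    then have "f y = zero M"
      using no_letters[OF y] value_state_iff[OF y] ya univ_eq by auto
    then show ?thesis using hom_word_zero[OF y a_univ ls_univ ya] by simp
  qed
  then show ?thesis unfolding evaluation_def using word_univ[OF a_univ ls_univ(1)] by blast
qed

end

section \<open>Locally evaluating maps are evaluations\<close>

context local_evaluation
begin

theorem f_is_evaluation: "evaluation A M f"
proof (cases "\<exists>x\<in>homs A M. f x \<in> letters M")
  case True
  then show ?thesis using evaluation_if_letter_value by blast
next
  case no_letters: False
  show ?thesis
  proof (cases "\<exists>x\<in>homs A M. f x \<in> states M")
    case True
    then obtain x\<^sub>1 where "x\<^sub>1 \<in> homs A M" "f x\<^sub>1 \<in> states M" by blast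
    then show ?thesis
    proof (rule principal_pattern[rotated])
      show "f x \<notin> letters M" if "x \<in> homs A M" for x using that no_letters by blast
      fix P L a x
      assume *: "pattern P L" "a \<in> P" "x \<in> homs A M" "f x \<in> states M"
      "state_part x = P" "letter_part x = L"
      "\<And>y. y \<in> homs A M \<Longrightarrow> f y \<in> states M \<longleftrightarrow> y a \<in> states M"
      "\<And>y s. y \<in> homs A M \<Longrightarrow> y a \<in> states M \<Longrightarrow> s \<in> L \<Longrightarrow> y s \<in> letters M"
      "\<And>p. p \<in> P \<Longrightarrow> \<exists>u w. set_mset u \<subseteq> L \<and> set_mset w \<subseteq> L \<and>
       (\<forall>y\<in>homs A M. y a \<in> states M \<longrightarrow> y p \<in> states M \<and>
          act (image_mset y u) (y p) = act (image_mset y w) (y a))"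
    show "evaluation A M f"
    proof (cases "L = {}")
      case True
      \<comment> \<open>Without letters there are no links inside \<open>P\<close>, so \<open>x\<close> can be cut down to the finite set \<open>B\<close>.\<close>
      have pat: "pattern (P \<inter> B) {}"
        using *(1) True unfolding pattern_def by blast
      define z where "z = cut x (P \<inter> B) {}"
      have z: "z \<in> homs A M"
        unfolding z_def by (rule cut_hom[OF *(3) pat]) (use *(5) in auto)
      have "f z = f x"
      proof (rule determined[OF z *(3)])
        fix b assume b: "b \<in> B"
        then have b': "b \<in> univ A" using B_univ by blast
        have "x b = zero M" if "b \<notin> P"
          using that *(5,6) True b' hom_univ[OF *(3) b'] univ_eq
          unfolding state_part_def letter_part_def by blast
        then show "z b = x b" using b b' by (auto simp: z_def cut_def)
      qed
      then have "f z \<noteq> zero M" using *(4) zero_not_state by metis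
      moreover have "{b \<in> univ A. z b \<noteq> zero M} \<subseteq> B"
        by (auto simp: z_def cut_def split: if_splits)
      ultimately show ?thesis
        using evaluation_if_finite_support[OF z] finite_B finite_subset by blast
    next
      case False
      interpret principal_evaluation M A f B P L a x
      proof
        show "f y \<notin> letters M" if "y \<in> homs A M" for y using that no_letters by blast
        show "f y \<in> states M \<longleftrightarrow> y a \<in> states M" if "y \<in> homs A M" for y by (rule *(7)[OF that])
        show "y s \<in> letters M" if "y \<in> homs A M" "y a \<in> states M" "s \<in> L" for y s
          by (rule *(8)[OF that])
      qed (fact * False)+
      show ?thesis by (rule evaluation_principal)
    qed
    qed
  next
    case False
    show ?thesis
    proof (rule evaluation_if_zero)
      fix x assume x: "x \<in> homs A M"
      obtain b where "b \<in> univ A" "f x = x b" by (rule locally'[of "{x}"]) (use x in auto)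
      then have "f x \<in> univ M" using hom_univ[OF x] by simp
      then show "f x = zero M" using x no_letters False univ_eq by blast
    qed
  qed
qed

end


section \<open>Finite determination and dualizability\<close>

text \<open>Each condition concerns one state and is read off in the component of that state. For
  injectivity, states with the same image under a letter lie in the same component.\<close>

lemma letter_affine_imp_affine_letters:
  fixes M :: "'a automatic"
  assumes "automatic_algebra M" "finite (univ M)" "letter_affine M"
  shows "affine_letters M"
proof -
  define E where "E = {(q, r) \<in> states M \<times> states M. (q, r) \<in> (state_graph M)\<^sup>*}"
  define C where "C q = E `` {q}" for q
  have self: "q \<in> C q" if "q \<in> states M" for q
    using that by (auto simp: C_def E_def)
  have C_states: "C q \<subseteq> states M" for q by (auto simp: C_def E_def)
  have lac: "letter_affine_connected (component_subalgebra M (C q))" if "q \<in> states M" for q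
  proof -
    have "C q \<in> components M"
      unfolding components_def C_def E_def[symmetric] using that by (rule quotientI)
    then show ?thesis using assms(3) unfolding letter_affine_def by blast
  qed
  define act where "act q = letter_action (component_subalgebra M (C q))" for q
  have act_eq: "act q a r = (if r \<in> C q then opn M r a else r)" for q a r
    by (simp add: act_def letter_action_def component_subalgebra_def)
  have perm: "act q a permutes C q" if "q \<in> states M" "a \<in> letters M" for q a
    using lac[OF that(1)] that(2)
    by (simp add: letter_affine_connected_def act_def component_subalgebra_def)
  have act_C: "act q a r \<in> C q" if "q \<in> states M" "a \<in> letters M" "r \<in> C q" for q a r
    using permutes_in_image[OF perm[OF that(1,2)]] that(3) by blast
  have comm: "act q a \<circ> act q b = act q b \<circ> act q a"
    if "q \<in> states M" "a \<in> letters M" "b \<in> letters M" for q a b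
    using lac[OF that(1)] that(2,3)
    by (simp add: letter_affine_connected_def act_def component_subalgebra_def)
  have aff: "\<exists>d\<in>letters M. act q a \<circ> inv (act q b) \<circ> act q c = act q d"
    if "q \<in> states M" "a \<in> letters M" "b \<in> letters M" "c \<in> letters M" for q a b c
    using lac[OF that(1)] that(2-)
    by (simp add: letter_affine_connected_def act_def component_subalgebra_def)
  have opn2: "act q b (act q a q) = opn M (opn M q a) b"
    if "q \<in> states M" "a \<in> letters M" for q a b
    using act_C[OF that self[OF that(1)]] self[OF that(1)] by (simp add: act_eq)
  have state: "opn M q a \<in> states M" if "q \<in> states M" "a \<in> letters M" for q a
    using act_C[OF that self[OF that(1)]] self[OF that(1)] C_states[of q] by (auto simp: act_eq)
  show ?thesis
  proof
    fix q q' a assume *: "q \<in> states M" "q' \<in> states M" "a \<in> letters M" "opn M q a = opn M q' a"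
    have "opn M q a \<in> states M" by (rule state[OF *(1,3)])
    then have "(q, opn M q a) \<in> state_graph M" "(opn M q a, q') \<in> state_graph M"
      using * unfolding state_graph_def by auto
    then have "(q, q') \<in> (state_graph M)\<^sup>*" by (meson converse_rtrancl_into_rtrancl r_into_rtrancl)
    then have "q' \<in> C q" using * by (auto simp: C_def E_def)
    then have "act q a q = act q a q'" using *(4) self[OF *(1)] by (simp add: act_eq)
    then show "q = q'" using permutes_inj[OF perm[OF *(1,3)]] by (meson injD)
  next
    fix q a b assume *: "q \<in> states M" "a \<in> letters M" "b \<in> letters M"
    show "opn M (opn M q a) b = opn M (opn M q b) a"
      using fun_cong[OF comm[OF *], of q] opn2[OF *(1,2), of b] opn2[OF *(1,3), of a] by simp
  next
    fix q a b c assume *: "q \<in> states M" "a \<in> letters M" "b \<in> letters M" "c \<in> letters M"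
    obtain d where d: "d \<in> letters M" "act q a \<circ> inv (act q b) \<circ> act q c = act q d"
      using aff[OF *] by blast
    have "opn M (opn M q b) d = act q d (act q b q)" using opn2[OF *(1,3)] by simp
    also have "\<dots> = act q a (inv (act q b) (act q c (act q b q)))"
      unfolding d(2)[symmetric] by simp
    also have "act q c (act q b q) = act q b (act q c q)"
      using fun_cong[OF comm[OF *(1,4,3)], of q] by simp
    also have "inv (act q b) (act q b (act q c q)) = act q c q"
      by (rule permutes_inverses(2)[OF perm[OF *(1,3)]])
    also have "act q a (act q c q) = act q c (act q a q)"
      using fun_cong[OF comm[OF *(1,2,4)], of q] by simp
    also have "\<dots> = opn M (opn M q a) c" by (rule opn2[OF *(1,2)])
    finally show "\<exists>d\<in>letters M. opn M (opn M q b) d = opn M (opn M q a) c"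
      using d(1) by blast
  qed (use assms state in auto)
qed

text \<open>For an enumeration \<open>g\<close> of \<open>X\<close>, the tuples \<open>(g 0 b, \<dots>, g (k - 1) b)\<close> with \<open>b\<close> in \<open>A\<close> form a
  subuniverse. Preserving it means to take on \<open>X\<close> the values of an evaluation.\<close>

lemma locally_evaluation_if_preserves:
  assumes A: "is_magma A" and M: "is_magma M"
    and pres: "\<And>k R. compatible_relation M k R \<Longrightarrow> preserves_relation A M f k R"
    and X: "finite X" "X \<noteq> {}" "X \<subseteq> homs A M"
  shows "\<exists>b\<in>univ A. \<forall>x\<in>X. f x = x b"
proof -
  define k where "k = card X"
  have "k \<ge> 1" using X by (simp add: k_def card_gt_0_iff Suc_le_eq)
  obtain g where g: "bij_betw g {..<k} X"
    using ex_bij_betw_nat_finite[OF X(1)] unfolding k_def atLeast0LessThan by blast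
  then have g_hom: "g i \<in> homs A M" if "i < k" for i
    using that X(3) unfolding bij_betw_def by blast
  have g_univ: "g i b \<in> univ M" if "i < k" "b \<in> univ A" for i b
    using g_hom[OF that(1)] that(2) unfolding homs_def by blast
  have g_opn: "g i (opn A b c) = opn M (g i b) (g i c)" if "i < k" "b \<in> univ A" "c \<in> univ A" for i b c
    using g_hom[OF that(1)] that(2,3) unfolding homs_def by blast
  define R where "R = (\<lambda>b. \<lambda>i\<in>{..<k}. g i b) ` univ A"
  have "R \<subseteq> {..<k} \<rightarrow>\<^sub>E univ M"
    unfolding R_def by (auto simp: g_univ split: if_splits)
  moreover have "(\<lambda>i\<in>{..<k}. opn M (x i) (y i)) \<in> R" if "x \<in> R" "y \<in> R" for x y
  proof -
    obtain b c where bc: "b \<in> univ A" "c \<in> univ A" "x = (\<lambda>i\<in>{..<k}. g i b)" "y = (\<lambda>i\<in>{..<k}. g i c)"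
      using \<open>x \<in> R\<close> \<open>y \<in> R\<close> unfolding R_def by blast
    then have "opn A b c \<in> univ A" using A unfolding is_magma_def subuniverse_def by blast
    moreover have "(\<lambda>i\<in>{..<k}. opn M (x i) (y i)) = (\<lambda>i\<in>{..<k}. g i (opn A b c))"
      using bc by (auto simp: fun_eq_iff g_opn)
    ultimately show ?thesis unfolding R_def by blast
  qed
  ultimately have "compatible_relation M k R"
    using \<open>k \<ge> 1\<close> unfolding compatible_relation_def subuniverse_def power_magma_def by simp
  then have "preserves_relation A M f k R" by (rule pres)
  moreover have "g \<in> {..<k} \<rightarrow> homs A M" using g_hom by auto
  moreover have "\<forall>b\<in>univ A. (\<lambda>i\<in>{..<k}. g i b) \<in> R" unfolding R_def by blast
  ultimately have "(\<lambda>i\<in>{..<k}. f (g i)) \<in> R" unfolding preserves_relation_def by blast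
  then obtain b where b: "b \<in> univ A" "(\<lambda>i\<in>{..<k}. f (g i)) = (\<lambda>i\<in>{..<k}. g i b)"
    unfolding R_def by blast
  have "f x = x b" if "x \<in> X" for x
  proof -
    have "x \<in> g ` {..<k}" using g that unfolding bij_betw_def by simp
    then obtain i where "i < k" "x = g i" by blast
    then show ?thesis using fun_cong[OF b(2), of i] by simp
  qed
  with b(1) show ?thesis by blast
qed

text \<open>The homomorphisms form a closed subset of a product of finite discrete spaces, so they are
  compact. By continuity, \<open>f\<close> is constant on a cylinder around each homomorphism, and finitely many
  of these cylinders cover.\<close>

lemma continuous_finitely_determined:
  assumes A: "is_magma A" and fin: "finite (univ M)"
    and cont: "continuous_map (hom_topology A M) (discrete_topology (univ M)) f"
  shows "\<exists>B. finite B \<and> B \<subseteq> univ A \<and>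
    (\<forall>x\<in>homs A M. \<forall>y\<in>homs A M. (\<forall>b\<in>B. x b = y b) \<longrightarrow> f x = f y)"
proof -
  define T where "T = product_topology (\<lambda>_. discrete_topology (univ M)) (univ A)"
  have topT: "topspace T = univ A \<rightarrow>\<^sub>E univ M" by (simp add: T_def)
  have homs_T: "homs A M \<subseteq> topspace T" unfolding topT homs_def by blast
  define cyl where "cyl x F = {y \<in> univ A \<rightarrow>\<^sub>E univ M. \<forall>b\<in>F. y b = x b}" for x and F :: "'a set"
  have cyl_open: "openin T (cyl x F)" if "x \<in> topspace T" "finite F" "F \<subseteq> univ A" for x F
  proof -
    have "cyl x F = (\<Pi>\<^sub>E b\<in>univ A. if b \<in> F then {x b} else univ M)"
      using that unfolding cyl_def topT by (auto simp: PiE_iff extensional_def split: if_splits)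
    moreover have "finite {b \<in> univ A. (if b \<in> F then {x b} else univ M) \<noteq> univ M}"
      by (rule finite_subset[OF _ that(2)]) auto
    ultimately show ?thesis
      unfolding T_def using that by (simp add: openin_PiE_gen topT PiE_iff) 
  qed
  have "closedin T (homs A M)"
  proof -
    have "openin T (topspace T - homs A M)"
    proof (subst openin_subopen, intro ballI)
      fix h assume h: "h \<in> topspace T - homs A M"
      then obtain x y where xy: "x \<in> univ A" "y \<in> univ A" "h (opn A x y) \<noteq> opn M (h x) (h y)"
        unfolding topT homs_def by blast
      let ?F = "{x, y, opn A x y}"
      have "?F \<subseteq> univ A" using A xy unfolding is_magma_def subuniverse_def by blast
      then have "openin T (cyl h ?F)" using h by (intro cyl_open) auto
      moreover have "h \<in> cyl h ?F" using h by (simp add: cyl_def topT)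
      moreover have "cyl h ?F \<subseteq> topspace T - homs A M"
        using xy by (auto simp: cyl_def topT homs_def)
      ultimately show "\<exists>U. openin T U \<and> h \<in> U \<and> U \<subseteq> topspace T - homs A M" by blast
    qed
    then show ?thesis using homs_T by (simp add: closedin_def)
  qed
  moreover have "compact_space T"
    unfolding T_def compact_space_product_topology using fin by (simp add: compact_space_discrete_topology)
  ultimately have compact: "compactin T (homs A M)" by (rule closedin_compact_space[rotated])
  have "\<exists>F. finite F \<and> F \<subseteq> univ A \<and> (\<forall>y\<in>homs A M. (\<forall>b\<in>F. y b = x b) \<longrightarrow> f y = f x)"
    if x: "x \<in> homs A M" for x
  proof -
    have top: "topspace (hom_topology A M) = homs A M"
      using homs_T unfolding hom_topology_def T_def[symmetric] by auto
    have "f x \<in> univ M" using cont x top by (auto simp: continuous_map_def)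
    then have "openin (hom_topology A M) {y \<in> homs A M. f y \<in> {f x}}"
      using openin_continuous_map_preimage[OF cont, of "{f x}"] unfolding top by simp
    then obtain V where V: "openin T V" "{y \<in> homs A M. f y \<in> {f x}} = V \<inter> homs A M"
      unfolding hom_topology_def T_def[symmetric] openin_subtopology by blast
    then have "x \<in> V" using x by blast
    then obtain X where X: "x \<in> Pi\<^sub>E (univ A) X" "finite {i. X i \<noteq> topspace (discrete_topology (univ M))}"
      "Pi\<^sub>E (univ A) X \<subseteq> V"
      using product_topology_open_contains_basis[OF V(1)[unfolded T_def]] by blast
    let ?F = "{i \<in> univ A. X i \<noteq> univ M}"
    have "f y = f x" if y: "y \<in> homs A M" "\<forall>b\<in>?F. y b = x b" for y
    proof -
      have "y b \<in> X b" if "b \<in> univ A" for b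
        using that y X(1) unfolding homs_def by (cases "X b = univ M") (auto simp: PiE_iff)
      moreover have "y \<in> extensional (univ A)" using y(1) by (auto simp: homs_def PiE_def)
      ultimately have "y \<in> Pi\<^sub>E (univ A) X" by (simp add: PiE_iff)
      then have "y \<in> V" using X(3) by blast
      then show ?thesis using V(2) y(1) by blast
    qed
    moreover have "finite ?F" by (rule finite_subset[OF _ X(2)]) auto
    ultimately show ?thesis by (intro exI[of _ ?F]) auto
  qed
  then have "\<forall>x\<in>homs A M. \<exists>F. finite F \<and> F \<subseteq> univ A \<and> (\<forall>y\<in>homs A M. (\<forall>b\<in>F. y b = x b) \<longrightarrow> f y = f x)"
    by blast
  from bchoice[OF this] obtain F where F_all: "\<forall>x\<in>homs A M. finite (F x) \<and> F x \<subseteq> univ A \<and>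
      (\<forall>y\<in>homs A M. (\<forall>b\<in>F x. y b = x b) \<longrightarrow> f y = f x)"
    by (elim exE)
  have F: "finite (F x)" "F x \<subseteq> univ A" "\<forall>y\<in>homs A M. (\<forall>b\<in>F x. y b = x b) \<longrightarrow> f y = f x"
    if "x \<in> homs A M" for x
    using bspec[OF F_all that] by blast+
  have "\<exists>\<U>. finite \<U> \<and> \<U> \<subseteq> (\<lambda>x. cyl x (F x)) ` homs A M \<and> homs A M \<subseteq> \<Union>\<U>"
  proof (rule compactinD[OF compact])
    show "openin T U" if "U \<in> (\<lambda>x. cyl x (F x)) ` homs A M" for U
      using that F homs_T by (auto intro!: cyl_open)
    show "homs A M \<subseteq> \<Union> ((\<lambda>x. cyl x (F x)) ` homs A M)"
      using homs_T by (auto simp: cyl_def topT)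
  qed
  then obtain D where D: "finite D" "D \<subseteq> homs A M" "homs A M \<subseteq> (\<Union>x\<in>D. cyl x (F x))"
  proof (elim exE conjE)
    fix \<U> assume \<U>: "finite \<U>" "\<U> \<subseteq> (\<lambda>x. cyl x (F x)) ` homs A M" "homs A M \<subseteq> \<Union>\<U>"
    obtain D where "D \<subseteq> homs A M" "finite D" "\<U> = (\<lambda>x. cyl x (F x)) ` D"
      using finite_subset_image[OF \<U>(1,2)] by blast
    then show thesis using that \<U>(3) by simp
  qed
  have "f x = f y"
    if x: "x \<in> homs A M" and "y \<in> homs A M" "\<forall>b\<in>(\<Union>x\<in>D. F x). x b = y b" for x y
  proof -
    obtain z where z: "z \<in> D" "x \<in> cyl z (F z)" using D(3) x by blast
    then have z_hom: "z \<in> homs A M" using D(2) by blast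
    have "\<forall>b\<in>F z. x b = z b" using z(2) by (simp add: cyl_def)
    moreover have "\<forall>b\<in>F z. x b = y b" using that(3) z(1) by blast
    ultimately have "\<forall>b\<in>F z. x b = z b" "\<forall>b\<in>F z. y b = z b" by simp_all
    then have "f x = f z" "f y = f z"
      using bspec[OF F(3)[OF z_hom] that(1)] bspec[OF F(3)[OF z_hom] that(2)] by blast+
    then show ?thesis by simp
  qed
  moreover have "finite (\<Union>x\<in>D. F x)" "(\<Union>x\<in>D. F x) \<subseteq> univ A"
    using D(1,2) F(1,2) by blast+
  ultimately show ?thesis by (intro exI[of _ "\<Union>x\<in>D. F x"] conjI ballI impI)
qed

theorem theorem5p2:
  fixes M :: "'a automatic"
  assumes "automatic_algebra M"
    and "finite (univ M)"
    and "letter_affine M"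
  shows "dualizable TYPE('b) TYPE('i) M"
  unfolding dualizable_def
proof (intro allI impI)
  fix A :: "'b magma" and f :: "('b \<Rightarrow> 'a) \<Rightarrow> 'a"
  assume "in_ISP TYPE('i) A M"
    and f: "continuous_map (hom_topology A M) (discrete_topology (univ M)) f \<and>
      (\<forall>k R. compatible_relation M k R \<longrightarrow> preserves_relation A M f k R)"
  then have A: "is_magma A" unfolding in_ISP_def by blast
  note cont = conjunct1[OF f]
  have pres: "preserves_relation A M f k R" if "compatible_relation M k R" for k R
    using conjunct2[OF f] that by blast
  interpret affine_letters M by (rule letter_affine_imp_affine_letters[OF assms])
  have opn_univ: "opn M x y \<in> univ M" if "x \<in> univ M" "y \<in> univ M" for x y
    using opn_zero[OF that] opn_state[of x y] univ_eq by blast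
  then have M: "is_magma M" unfolding is_magma_def subuniverse_def by blast
  obtain B where B: "finite B" "B \<subseteq> univ A"
    "\<forall>x\<in>homs A M. \<forall>y\<in>homs A M. (\<forall>b\<in>B. x b = y b) \<longrightarrow> f x = f y"
    using continuous_finitely_determined[OF A assms(2) cont]
    by (elim exE conjE) (rule that; assumption)
  let ?z = "\<lambda>b\<in>univ A. zero M"
  have z: "?z \<in> homs A M"
    using A univ_eq opn_zero[of "zero M" "zero M"] zero_not_state
    unfolding homs_def is_magma_def subuniverse_def by auto
  interpret local_evaluation M A f B
  proof
    fix X assume X: "finite X" "X \<subseteq> homs A M"
    have "\<exists>b\<in>univ A. \<forall>x\<in>insert ?z X. f x = x b"
      by (rule locally_evaluation_if_preserves[OF A M pres]) (use X z in auto)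
    then show "\<exists>b\<in>univ A. \<forall>x\<in>X. f x = x b" by blast
  next
    show "f x = f y" if "x \<in> homs A M" "y \<in> homs A M" "\<And>b. b \<in> B \<Longrightarrow> x b = y b" for x y
      using bspec[OF bspec[OF B(3) that(1)] that(2)] that(3) by blast
  qed (fact A B)+
  show "evaluation A M f" by (rule f_is_evaluation)
qed

end
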